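(* Suppose that $m$ changes sign in the interval $]T_1,T_2[$, and let $N\in\{1,2,\dots,+\infty\}$ be the number of changes of sign of $m$. Then the spectrum $\Sigma^*$ associated to the problem $$Lu=m(t)[au^+-bu^-]\ \text{in } ]T_1,T_2[,\qquad u'(T_1)=0=u'(T_2)$$ contains exactly $2N-1$ hyperbolic like curves in each one of the two quadrants $\mathbb{R}_+\times\mathbb{R}_-$ and $\mathbb{R}_-\times\mathbb{R}_+$.
   Context: Let $T_1<T_2$ be real numbers, $p,q,m\in C[T_1,T_2]$ with $p(t)>0$ and $q(t)\ge 0$ on $[T_1,T_2]$, $m\not\equiv 0$, and $Lu:=-[p(t)u']'+q(t)u$. For a function $w$, write $w^\pm:=\max\{\pm w,0\}$; $\mathbb{R}_+=[0,+\infty[$, $\mathbb{R}_-=\,]-\infty,0]$. "$m$ changes sign" means $m^+\not\equiv0$ and $m^-\not\equiv0$. For $k\ge0$, $C_k^>$ (resp. $C_k^<$) is the set of $(a,b)\in\mathbb{R}^2$ such that the problem in the claim has a nontrivial solution with exactly $k$ zeros in $]T_1,T_2[$ and with $u(T_2)>0$ (resp. $u(T_2)<0$). Put $\Sigma^*:=\bigcup_{k\ge1}(C_k^>\cup C_k^<)$. The number of hyperbolic like curves of $\Sigma^*$ in a quadrant $Q$ is the number (possibly $+\infty$) of nonempty sets among $C_k^>\cap Q$, $C_k^<\cap Q$, $k\ge1$; curves that coincide are counted twice. Each such nonempty set is the graph of a strictly monotone $C^1$-diffeomorphism between two unbounded open intervals. Number of changes of sign. (1) $s\in\,]T_1,T_2[$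 is a simple point of change of sign of $m$ if there exist $T_1<s'\le s$ and $\epsilon_0>0$ such that either (i) for every $0<\epsilon<\epsilon_0$, $m\le0$ and $m\not\equiv0$ on $]s'-\epsilon,s'[$, $m\equiv0$ on $[s',s]$, and $m\ge0$, $m\not\equiv0$ on $]s,s+\epsilon[$; or (ii) for every $0<\epsilon<\epsilon_0$, $m\ge0$ and $m\not\equiv0$ on $]s'-\epsilon,s'[$, $m\equiv0$ on $[s',s]$, and $m\le0$, $m\not\equiv0$ on $]s,s+\epsilon[$. (2) $s\in[T_1,T_2]$ is a multiple point of change of sign of $m$ if either (i) $s>T_1$ and $m^+,m^-$ are both $\not\equiv0$ on $]s-\epsilon,s[\,\cap[T_1,T_2]$ for every $\epsilon>0$, or (ii) $s<T_2$ and $m^+,m^-$ are both $\not\equiv0$ on $]s,s+\epsilon[\,\cap[T_1,T_2]$ for every $\epsilon>0$. (3) If $m$ has only simple points of change of sign in $]T_1,T_2[$ and $N\in\mathbb{N}$ is the exact number of these points, the number of changes of sign of $m$ is $N$; if $m$ has at least one multiple point of change of sign in $[T_1,T_2]$, the number of changes of sign of $m$ is $+\infty$. *)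

theory Defs
  imports "HOL-Analysis.Analysis"
begin

definition pos_part :: "(real \<Rightarrow> real) \<Rightarrow> real \<Rightarrow> real" where
  "pos_part w t = max (w t) 0"

definition neg_part :: "(real \<Rightarrow> real) \<Rightarrow> real \<Rightarrow> real" where
  "neg_part w t = max (- w t) 0"

definition nonzero_on :: "(real \<Rightarrow> real) \<Rightarrow> real set \<Rightarrow> bool" where
  "nonzero_on w A \<longleftrightarrow> (\<exists>t\<in>A. w t \<noteq> 0)"

definition changes_sign_on :: "(real \<Rightarrow> real) \<Rightarrow> real set \<Rightarrow> bool" where
  "changes_sign_on w A \<longleftrightarrow> nonzero_on (pos_part w) A \<and> nonzero_on (neg_part w) A"

(* Cardinality in N with +infinity; \<open>card\<close> alone would send infinite sets to 0. *)
definition ecard :: "'a set \<Rightarrow> enat" where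
  "ecard A = (if finite A then enat (card A) else \<infinity>)"


text \<open>
  Since \<open>p\<close> is merely continuous, \<open>L u = - (p u')' + q u\<close> is a quasi-derivative expression:
  \<open>u\<close> is \<open>C\<^sup>1\<close> on the closed interval (derivatives one-sided at the end points) and the product
  \<open>p u'\<close>, rather than \<open>u'\<close>, is differentiable in the open interval.  The function \<open>u'\<close> is
  uniquely determined on \<open>[T1, T2]\<close> when \<open>T1 < T2\<close>, and values of \<open>u\<close> outside \<open>[T1, T2]\<close> play
  no role.
\<close>

definition neumann_solution ::
  "(real \<Rightarrow> real) \<Rightarrow> (real \<Rightarrow> real) \<Rightarrow> (real \<Rightarrow> real) \<Rightarrow> real \<Rightarrow> real \<Rightarrow> real \<Rightarrow> real
    \<Rightarrow> (real \<Rightarrow> real) \<Rightarrow> bool" where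
  "neumann_solution p q m T1 T2 a b u \<longleftrightarrow>
    (\<exists>u'. continuous_on {T1..T2} u'
        \<and> (\<forall>t\<in>{T1..T2}. (u has_real_derivative u' t) (at t within {T1..T2}))
        \<and> (\<forall>t\<in>{T1<..<T2}. \<exists>w. ((\<lambda>s. p s * u' s) has_real_derivative w) (at t)
              \<and> - w + q t * u t = m t * (a * pos_part u t - b * neg_part u t))
        \<and> u' T1 = 0 \<and> u' T2 = 0)"

definition has_exactly_k_zeros :: "nat \<Rightarrow> (real \<Rightarrow> real) \<Rightarrow> real set \<Rightarrow> bool" where
  "has_exactly_k_zeros k u A \<longleftrightarrow> finite {t\<in>A. u t = 0} \<and> card {t\<in>A. u t = 0} = k"

definition C_gt ::
  "(real \<Rightarrow> real) \<Rightarrow> (real \<Rightarrow> real) \<Rightarrow> (real \<Rightarrow> real) \<Rightarrow> real \<Rightarrow> real \<Rightarrow> nat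
    \<Rightarrow> (real \<times> real) set" where
  "C_gt p q m T1 T2 k = {(a, b). \<exists>u. neumann_solution p q m T1 T2 a b u
      \<and> nonzero_on u {T1..T2} \<and> has_exactly_k_zeros k u {T1<..<T2} \<and> u T2 > 0}"

definition C_lt ::
  "(real \<Rightarrow> real) \<Rightarrow> (real \<Rightarrow> real) \<Rightarrow> (real \<Rightarrow> real) \<Rightarrow> real \<Rightarrow> real \<Rightarrow> nat
    \<Rightarrow> (real \<times> real) set" where
  "C_lt p q m T1 T2 k = {(a, b). \<exists>u. neumann_solution p q m T1 T2 a b u
      \<and> nonzero_on u {T1..T2} \<and> has_exactly_k_zeros k u {T1<..<T2} \<and> u T2 < 0}"

text \<open>
  Number of hyperbolic like curves in \<open>Q\<close> of \<open>\<Sigma>*\<close>, the union of all \<open>C_gt k\<close> and \<open>C_lt k\<close> with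
  \<open>k \<ge> 1\<close>.  The indices of the nonempty pieces are counted, not the pieces as sets of points, so
  that coinciding curves are counted twice.
\<close>

definition num_hyperbolic_like_curves ::
  "(real \<Rightarrow> real) \<Rightarrow> (real \<Rightarrow> real) \<Rightarrow> (real \<Rightarrow> real) \<Rightarrow> real \<Rightarrow> real \<Rightarrow> (real \<times> real) set
    \<Rightarrow> enat" where
  "num_hyperbolic_like_curves p q m T1 T2 Q =
     ecard {k. 1 \<le> k \<and> C_gt p q m T1 T2 k \<inter> Q \<noteq> {}}
     + ecard {k. 1 \<le> k \<and> C_lt p q m T1 T2 k \<inter> Q \<noteq> {}}"


text \<open>
  Shrinking \<open>e0\<close> keeps the intervals below inside \<open>]T1, T2[\<close>, so values of \<open>m\<close> outside
  \<open>[T1, T2]\<close> do not influence this notion.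
\<close>

definition simple_change_point :: "(real \<Rightarrow> real) \<Rightarrow> real \<Rightarrow> real \<Rightarrow> real \<Rightarrow> bool" where
  "simple_change_point m T1 T2 s \<longleftrightarrow> s \<in> {T1<..<T2} \<and>
    (\<exists>s' e0. T1 < s' \<and> s' \<le> s \<and> 0 < e0 \<and>
      ((\<forall>e. 0 < e \<and> e < e0 \<longrightarrow>
           (\<forall>t\<in>{s'-e<..<s'}. m t \<le> 0) \<and> nonzero_on m {s'-e<..<s'}
         \<and> (\<forall>t\<in>{s'..s}. m t = 0)
         \<and> (\<forall>t\<in>{s<..<s+e}. m t \<ge> 0) \<and> nonzero_on m {s<..<s+e})
       \<or>
       (\<forall>e. 0 < e \<and> e < e0 \<longrightarrow>
           (\<forall>t\<in>{s'-e<..<s'}. m t \<ge> 0) \<and> nonzero_on m {s'-e<..<s'}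
         \<and> (\<forall>t\<in>{s'..s}. m t = 0)
         \<and> (\<forall>t\<in>{s<..<s+e}. m t \<le> 0) \<and> nonzero_on m {s<..<s+e})))"

definition multiple_change_point :: "(real \<Rightarrow> real) \<Rightarrow> real \<Rightarrow> real \<Rightarrow> real \<Rightarrow> bool" where
  "multiple_change_point m T1 T2 s \<longleftrightarrow> s \<in> {T1..T2} \<and>
    ((s > T1 \<and> (\<forall>e>0. changes_sign_on m ({s-e<..<s} \<inter> {T1..T2})))
     \<or> (s < T2 \<and> (\<forall>e>0. changes_sign_on m ({s<..<s+e} \<inter> {T1..T2}))))"

definition num_sign_changes :: "(real \<Rightarrow> real) \<Rightarrow> real \<Rightarrow> real \<Rightarrow> enat" where
  "num_sign_changes m T1 T2 =
    (if \<exists>s. multiple_change_point m T1 T2 s then \<infinity>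
     else ecard {s. simple_change_point m T1 T2 s})"

end

theory Submission
  imports Defs
begin

text \<open>
  For \<open>a \<ge> 0 \<ge> b\<close> a positive nodal interval of a solution must meet \<open>{m > 0}\<close> and a negative one
  \<open>{m < 0}\<close>, since otherwise \<open>p u'\<close> would be monotone there in the wrong direction.  So a solution with
  \<open>k\<close> zeros and \<open>u(T2) > 0\<close> yields points \<open>t_0 < \<dots> < t_k\<close> at which \<open>m\<close> alternates in sign and
  \<open>m(t_k) > 0\<close>.  Conversely, from such points a solution is found already on the line
  \<open>(a, b) = (lam, - lam)\<close> by shooting: the Pruefer angle that starts at \<open>- k \<pi>\<close> ends at or below
  \<open>0\<close> for \<open>lam = 0\<close>, while for large \<open>lam\<close> it makes a half turn near each \<open>t_i\<close> and ends at or above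
  \<open>\<pi>/2\<close>.  The substitutions \<open>u \<mapsto> - u\<close> and \<open>m \<mapsto> - m\<close> reduce \<open>C_lt\<close> and the other quadrant to this
  case.  With \<open>N < \<infinity>\<close> sign changes, both final signs occur for \<open>1 \<le> k < N\<close>, exactly one for
  \<open>k = N\<close> and none for \<open>k > N\<close>, which gives \<open>2 N - 1\<close> nonempty sets.
\<close>

section \<open>Alternation and sign changes\<close>

text \<open>The criterion by alternating points involves neither \<open>p\<close> nor
  \<open>q\<close>, and a single point per index decides whether a set is nonempty, so the shape of
  the curves never enters. The line \<open>(lam, - lam)\<close> is convenient because the right-hand
  side becomes \<open>lam * m * abs u\<close>: it is positively homogeneous, so the angle equation
  does not contain the amplitude, and replacing \<open>u\<close> by \<open>- u\<close> amounts to
  replacing \<open>m\<close> by \<open>- m\<close>. Both directions are therefore inductions that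
  split off the last nodal interval, or the last half turn, and continue with \<open>- m\<close> on
  what lies to the left. \<open>alternation\<close> is built in the same way: it is peeled from its
  final point, where the current weight is always positive. Since \<open>m\<close> may vanish on
  whole intervals and \<open>p\<close> is only continuous, arguments use witnesses of strict sign
  for \<open>m\<close>, and the flux \<open>p u'\<close> instead of \<open>u'\<close>.\<close>

primrec alternation :: "real \<Rightarrow> nat \<Rightarrow> (real \<Rightarrow> real) \<Rightarrow> real \<Rightarrow> bool" where
  "alternation lo 0 m t \<longleftrightarrow> lo < t \<and> m t > 0"
| "alternation lo (Suc k) m t \<longleftrightarrow> m t > 0 \<and> (\<exists>s<t. alternation lo k (\<lambda>x. - m x) s)"

definition alternates :: "real \<Rightarrow> real \<Rightarrow> nat \<Rightarrow> (real \<Rightarrow> real) \<Rightarrow> bool" where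
  "alternates T1 T2 k m \<longleftrightarrow> (\<exists>t<T2. alternation T1 k m t)"

lemma alternation_pos: "alternation lo k m t \<Longrightarrow> m t > 0"
  by (cases k) auto

lemma alternation_gt: "alternation lo k m t \<Longrightarrow> lo < t"
proof (induction k arbitrary: m t)
  case (Suc k)
  then obtain s where s: "s < t" "alternation lo k (\<lambda>x. - m x) s" by auto
  from Suc.IH[OF s(2)] s(1) show ?case by simp
qed simp

text \<open>The first point is the one that is dropped, so the final point and its sign survive.
  Dropping the final point instead reverses the final sign; that is
  \<open>alternates_Suc_imp_uminus\<close>.\<close>

lemma alternation_Suc_imp: "alternation lo (Suc k) m t \<Longrightarrow> alternation lo k m t"
proof (induction k arbitrary: m t)
  case 0
  then show ?case by auto
next
  case (Suc k)
  then obtain s where s: "s < t" "alternation lo (Suc k) (\<lambda>x. - m x) s" "m t > 0"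
    unfolding alternation.simps(2)[of _ "Suc k"] by blast
  from Suc.IH[OF s(2)] s show ?case by auto
qed

lemma alternates_Suc_imp: "alternates T1 T2 (Suc k) m \<Longrightarrow> alternates T1 T2 k m"
  unfolding alternates_def using alternation_Suc_imp by blast

lemma alternates_Suc_imp_uminus: "alternates T1 T2 (Suc k) m \<Longrightarrow> alternates T1 T2 k (\<lambda>x. - m x)"
  unfolding alternates_def by (metis alternation.simps(2) order.strict_trans)

lemma alternates_mono: "alternates T1 T2 k m \<Longrightarrow> j \<le> k \<Longrightarrow> alternates T1 T2 j m"
  by (induction k) (auto simp: le_Suc_eq dest: alternates_Suc_imp)

text \<open>The two final points differ because \<open>m\<close> has opposite signs there, and the
  later one can be appended to the alternation that ends at the earlier one. Hence at the maximal
  index only one final sign occurs, which is the origin of the \<open>- 1\<close> in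
  \<open>2 * N - 1\<close>.\<close>

lemma alternates_both:
  assumes "alternates T1 T2 k m" "alternates T1 T2 k (\<lambda>x. - m x)"
  shows "alternates T1 T2 (Suc k) m \<or> alternates T1 T2 (Suc k) (\<lambda>x. - m x)"
proof -
  obtain s t where s: "s < T2" "alternation T1 k m s" and t: "t < T2" "alternation T1 k (\<lambda>x. - m x) t"
    using assms by (auto simp: alternates_def)
  have "s \<noteq> t" using alternation_pos[OF s(2)] alternation_pos[OF t(2)] by auto
  then consider "s < t" | "t < s" by linarith
  then show ?thesis
  proof cases
    case 1
    then have "alternation T1 (Suc k) (\<lambda>x. - m x) t"
      using alternation_pos[OF t(2)] s(2) by auto
    then show ?thesis using t by (auto simp: alternates_def)
  next
    case 2
    then have "alternation T1 (Suc k) m s"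
      using alternation_pos[OF s(2)] t(2) by auto
    then show ?thesis using s by (auto simp: alternates_def)
  qed
qed

section \<open>From points of change of sign to alternations\<close>

lemma changes_sign_on_iff:
  "changes_sign_on m A \<longleftrightarrow> (\<exists>t\<in>A. m t > 0) \<and> (\<exists>t\<in>A. m t < 0)"
  by (auto simp: changes_sign_on_def nonzero_on_def pos_part_def neg_part_def max_def not_le)

lemma multiple_change_point_alternates:
  assumes "multiple_change_point m T1 T2 s"
  shows "alternates T1 T2 k m"
proof -
  have s: "T1 \<le> s" "s \<le> T2" using assms by (auto simp: multiple_change_point_def)
  consider "s > T1" "\<forall>e>0. changes_sign_on m ({s-e<..<s} \<inter> {T1..T2})"
    | "s < T2" "\<forall>e>0. changes_sign_on m ({s<..<s+e} \<inter> {T1..T2})"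
    using assms by (auto simp: multiple_change_point_def)
  then show ?thesis
  proof cases
    case 1
    have *: "(\<exists>t\<in>{y<..<s}. m t > 0) \<and> (\<exists>t\<in>{y<..<s}. m t < 0)" if "y < s" for y
      using 1(2)[rule_format, of "s - y"] that by (auto simp: changes_sign_on_iff)
    \<comment> \<open>Accumulation from the left: a further point can always be appended between the
      current final point and \<open>s\<close>. The property of \<open>f\<close> is symmetric under
      negation, so the induction can pass to \<open>- f\<close>.\<close>
    have "\<exists>t<s. alternation T1 k f t"
      if "\<And>y. y < s \<Longrightarrow> (\<exists>t\<in>{y<..<s}. f t > 0) \<and> (\<exists>t\<in>{y<..<s}. f t < 0)" for f
      using that
    proof (induction k arbitrary: f)
      case 0
      then show ?case using 1(1) by fastforce
    next
      case (Suc k)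
      have "\<exists>t<s. alternation T1 k (\<lambda>x. - f x) t"
        by (rule Suc.IH) (use Suc.prems in force)
      then obtain t where t: "t < s" "alternation T1 k (\<lambda>x. - f x) t" by blast
      moreover obtain r where "t < r" "r < s" "f r > 0" using Suc.prems[OF t(1)] by auto
      ultimately show ?case using t by (intro exI[of _ r]) auto
    qed
    from this[OF *] obtain t where "t < s" "alternation T1 k m t" by blast
    then show ?thesis using s by (auto simp: alternates_def intro!: exI[of _ t])
  next
    case 2
    have *: "(\<exists>t\<in>{s<..<y}. m t > 0) \<and> (\<exists>t\<in>{s<..<y}. m t < 0)" if "s < y" for y
      using 2(2)[rule_format, of "y - s"] that by (auto simp: changes_sign_on_iff)
    \<comment> \<open>Accumulation from the right: the final point is chosen first and the earlier
      ones are squeezed between \<open>s\<close> and it, so the right bound \<open>y\<close> has to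
      vary in the induction.\<close>
    have "\<exists>t\<in>{s<..<y}. alternation T1 k f t"
      if "\<And>y. s < y \<Longrightarrow> (\<exists>t\<in>{s<..<y}. f t > 0) \<and> (\<exists>t\<in>{s<..<y}. f t < 0)" "s < y" for f y
      using that
    proof (induction k arbitrary: f y)
      case 0
      then show ?case using s(1) by fastforce
    next
      case (Suc k)
      obtain t where t: "t \<in> {s<..<y}" "f t > 0" using Suc.prems by blast
      have "\<exists>r\<in>{s<..<t}. alternation T1 k (\<lambda>x. - f x) r"
        by (rule Suc.IH) (use Suc.prems t in force)+
      with t show ?case unfolding alternation.simps by (intro bexI[of _ t]) auto
    qed
    from this[OF * 2(1)] show ?thesis by (auto simp: alternates_def)
  qed
qed

lemma simple_change_point_uminus:
  "simple_change_point (\<lambda>x. - m x) T1 T2 s \<longleftrightarrow> simple_change_point m T1 T2 s"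
proof -
  have nz: "nonzero_on (\<lambda>x. - m x) A \<longleftrightarrow> nonzero_on m A" for A
    by (simp add: nonzero_on_def)
  show ?thesis
    unfolding simple_change_point_def nz neg_equal_0_iff_equal neg_le_0_iff_le neg_0_le_iff_le
    by (subst disj_commute) (rule refl)
qed

lemma multiple_change_point_uminus:
  "multiple_change_point (\<lambda>x. - m x) T1 T2 s \<longleftrightarrow> multiple_change_point m T1 T2 s"
  unfolding multiple_change_point_def changes_sign_on_iff by (simp add: conj_commute)

text \<open>A change from minus to plus reduced to what alternations use: strict witnesses
  arbitrarily close on either side of the flat piece \<open>{s'..s}\<close>. A change from plus to
  minus is an upward point of \<open>- m\<close>.\<close>

definition upward_point :: "real \<Rightarrow> (real \<Rightarrow> real) \<Rightarrow> real \<Rightarrow> bool" where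
  "upward_point T1 m s \<longleftrightarrow> (\<exists>s'. T1 < s' \<and> s' \<le> s \<and> (\<forall>t\<in>{s'..s}. m t = 0)
     \<and> (\<forall>c<s'. \<exists>t\<in>{c<..<s'}. m t < 0) \<and> (\<forall>d>s. \<exists>t\<in>{s<..<d}. m t > 0))"

lemma one_sided_witnesses:
  fixes m :: "real \<Rightarrow> real"
  assumes "0 < e0"
    and "\<And>e. 0 < e \<Longrightarrow> e < e0 \<Longrightarrow>
           (\<forall>t\<in>{s'-e<..<s'}. m t \<le> 0) \<and> nonzero_on m {s'-e<..<s'}
         \<and> (\<forall>t\<in>{s<..<s+e}. m t \<ge> 0) \<and> nonzero_on m {s<..<s+e}"
  shows "c < s' \<Longrightarrow> \<exists>t\<in>{c<..<s'}. m t < 0" and "s < d \<Longrightarrow> \<exists>t\<in>{s<..<d}. m t > 0"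
proof -
  assume "c < s'"
  define e where "e = min (e0/2) (s' - c)"
  have "0 < e" "e < e0" "e \<le> s' - c" using \<open>c < s'\<close> \<open>0 < e0\<close> by (auto simp: e_def)
  with assms(2)[of e] obtain t where "t \<in> {s'-e<..<s'}" "m t \<noteq> 0" "m t \<le> 0"
    unfolding nonzero_on_def by blast
  with \<open>e \<le> s' - c\<close> show "\<exists>t\<in>{c<..<s'}. m t < 0" by (intro bexI[of _ t]) auto
next
  assume "s < d"
  define e where "e = min (e0/2) (d - s)"
  have "0 < e" "e < e0" "e \<le> d - s" using \<open>s < d\<close> \<open>0 < e0\<close> by (auto simp: e_def)
  with assms(2)[of e] obtain t where "t \<in> {s<..<s+e}" "m t \<noteq> 0" "m t \<ge> 0"
    unfolding nonzero_on_def by blast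
  with \<open>e \<le> d - s\<close> show "\<exists>t\<in>{s<..<d}. m t > 0" by (intro bexI[of _ t]) auto
qed

lemma simple_change_point_imp_upward:
  assumes "simple_change_point m T1 T2 s"
  shows "upward_point T1 m s \<or> upward_point T1 (\<lambda>x. - m x) s"
proof -
  have key: "upward_point T1 f s" if that: "T1 < s'" "s' \<le> s" "0 < e0" and f:
      "\<forall>e. 0 < e \<and> e < e0 \<longrightarrow>
           (\<forall>t\<in>{s'-e<..<s'}. f t \<le> 0) \<and> nonzero_on f {s'-e<..<s'}
         \<and> (\<forall>t\<in>{s'..s}. f t = 0)
         \<and> (\<forall>t\<in>{s<..<s+e}. f t \<ge> 0) \<and> nonzero_on f {s<..<s+e}" for f s' e0
  proof -
    have zero: "\<forall>t\<in>{s'..s}. f t = 0"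
      using f[rule_format, of "e0/2"] that(3) by (simp del: divide_less_eq)
    have wit: "(\<forall>t\<in>{s'-e<..<s'}. f t \<le> 0) \<and> nonzero_on f {s'-e<..<s'}
         \<and> (\<forall>t\<in>{s<..<s+e}. f t \<ge> 0) \<and> nonzero_on f {s<..<s+e}" if "0 < e" "e < e0" for e
      using f[rule_format, of e] that by blast
    show ?thesis
      unfolding upward_point_def
      using that(1,2) zero one_sided_witnesses[OF that(3) wit]
      by (intro exI[of _ s'] conjI allI impI)
  qed
  from assms obtain s' e0 where *: "T1 < s'" "s' \<le> s" "0 < e0" and
    disj: "((\<forall>e. 0 < e \<and> e < e0 \<longrightarrow>
           (\<forall>t\<in>{s'-e<..<s'}. m t \<le> 0) \<and> nonzero_on m {s'-e<..<s'}
         \<and> (\<forall>t\<in>{s'..s}. m t = 0)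
         \<and> (\<forall>t\<in>{s<..<s+e}. m t \<ge> 0) \<and> nonzero_on m {s<..<s+e})
       \<or>
       (\<forall>e. 0 < e \<and> e < e0 \<longrightarrow>
           (\<forall>t\<in>{s'-e<..<s'}. m t \<ge> 0) \<and> nonzero_on m {s'-e<..<s'}
         \<and> (\<forall>t\<in>{s'..s}. m t = 0)
         \<and> (\<forall>t\<in>{s<..<s+e}. m t \<le> 0) \<and> nonzero_on m {s<..<s+e}))"
    unfolding simple_change_point_def by blast
  from disj show ?thesis
  proof
    assume "\<forall>e. 0 < e \<and> e < e0 \<longrightarrow>
           (\<forall>t\<in>{s'-e<..<s'}. m t \<le> 0) \<and> nonzero_on m {s'-e<..<s'}
         \<and> (\<forall>t\<in>{s'..s}. m t = 0)
         \<and> (\<forall>t\<in>{s<..<s+e}. m t \<ge> 0) \<and> nonzero_on m {s<..<s+e}"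
    from key[OF * this] show ?thesis ..
  next
    assume "\<forall>e. 0 < e \<and> e < e0 \<longrightarrow>
           (\<forall>t\<in>{s'-e<..<s'}. m t \<ge> 0) \<and> nonzero_on m {s'-e<..<s'}
         \<and> (\<forall>t\<in>{s'..s}. m t = 0)
         \<and> (\<forall>t\<in>{s<..<s+e}. m t \<le> 0) \<and> nonzero_on m {s<..<s+e}"
    then show ?thesis by (intro disjI2 key[OF *]) (auto simp: nonzero_on_def)
  qed
qed

text \<open>The flat piece that ends at \<open>s\<close> cannot reach back to \<open>c\<close>,
  since \<open>m\<close> is nonzero arbitrarily close to the right of \<open>c\<close>; so the
  negative witnesses left of \<open>s'\<close> can be taken right of \<open>c\<close>.\<close>

lemma upward_point_left:
  assumes "upward_point T1 m s" "c < s" "\<And>d. c < d \<Longrightarrow> \<exists>t\<in>{c<..<d}. m t \<noteq> 0"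
  shows "\<exists>t\<in>{c<..<s}. m t < 0"
proof -
  obtain s' where s': "s' \<le> s" "\<forall>t\<in>{s'..s}. m t = 0" "\<forall>c<s'. \<exists>t\<in>{c<..<s'}. m t < 0"
    using assms(1) by (auto simp: upward_point_def)
  have "c < s'"
  proof (rule ccontr)
    assume "\<not> c < s'"
    with s'(2) assms(2) assms(3)[of s] show False by fastforce
  qed
  with s' show ?thesis by fastforce
qed

lemma upward_point_right: "upward_point T1 m s \<Longrightarrow> s < d \<Longrightarrow> \<exists>t\<in>{s<..<d}. m t > 0"
  by (auto simp: upward_point_def)

text \<open>Induction on the largest point. That neighbouring points change in opposite directions
  is never proved: whichever way the preceding point \<open>r\<close> changes, a negative value
  \<open>t'\<close> lies strictly between \<open>r\<close> and the largest point, and this settles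
  both cases.\<close>

lemma simple_change_points_alternation:
  assumes "finite S" "card S = Suc n" "\<And>s. s \<in> S \<Longrightarrow> simple_change_point m T1 T2 s"
    and "upward_point T1 m (Max S)" "Max S < d"
  shows "\<exists>t\<in>{Max S<..<d}. alternation T1 (Suc n) m t"
  using assms
proof (induction n arbitrary: S m d)
  case 0
  then obtain s where S: "S = {s}" by (auto simp: card_1_singleton_iff)
  then have up: "upward_point T1 m s" "s < d" using 0 by simp_all
  then obtain s' where "T1 < s'" "s' \<le> s" "\<forall>c<s'. \<exists>t\<in>{c<..<s'}. m t < 0"
    unfolding upward_point_def by blast
  then obtain t' where t': "T1 < t'" "t' < s" "m t' < 0" by fastforce
  obtain t where "t \<in> {s<..<d}" "m t > 0" using upward_point_right[OF up] by blast
  then show ?case using S t' by (intro bexI[of _ t]) (auto intro!: exI[of _ t'])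
next
  case (Suc n)
  define s S' r where "s = Max S" and "S' = S - {s}" and "r = Max S'"
  have sS: "s \<in> S" using Suc.prems by (auto simp: s_def intro!: Max_in)
  have S': "finite S'" "card S' = Suc n" using Suc.prems sS by (auto simp: S'_def)
  then have rS: "r \<in> S'" by (auto simp: r_def intro!: Max_in)
  then have "r < s" using Suc.prems sS Max_ge[of S r] by (auto simp: S'_def s_def less_le)
  have simp': "simple_change_point m T1 T2 x" if "x \<in> S'" for x
    using Suc.prems(3) that by (auto simp: S'_def)
  then have r: "upward_point T1 m r \<or> upward_point T1 (\<lambda>x. - m x) r"
    using rS simple_change_point_imp_upward by blast
  then have "\<exists>t\<in>{r<..<d}. m t \<noteq> 0" if "r < d" for d
    using upward_point_right[of T1 m r d] upward_point_right[of T1 "\<lambda>x. - m x" r d] that by force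
  then obtain t' where t': "r < t'" "t' < s" "m t' < 0"
    using upward_point_left[OF Suc.prems(4)] \<open>r < s\<close> s_def by fastforce
  have alt': "\<exists>x<s. alternation T1 (Suc n) (\<lambda>x. - m x) x"
    using r
  proof
    \<comment> \<open>Two upward changes in a row give one point too many: \<open>t'\<close> is
      appended to the alternation found near \<open>r\<close>, and the first point is dropped to
      restore the index.\<close>
    assume "upward_point T1 m r"
    then obtain x where "x < t'" "alternation T1 (Suc n) m x"
      using Suc.IH[OF S' simp', where d = t'] t'(1) unfolding r_def by (metis greaterThanLessThan_iff)
    then have "alternation T1 (Suc (Suc n)) (\<lambda>x. - m x) t'"
      using t' unfolding alternation.simps(2)[of _ "Suc n"] minus_minus by auto
    then show ?thesis using t'(2) alternation_Suc_imp by blast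
  next
    assume "upward_point T1 (\<lambda>x. - m x) r"
    then obtain x where "x < t'" "alternation T1 (Suc n) (\<lambda>x. - m x) x"
      using Suc.IH[OF S', where m = "\<lambda>x. - m x" and d = t'] simp' t'(1)
      unfolding r_def simple_change_point_uminus by (metis greaterThanLessThan_iff)
    then show ?thesis using t'(2) by (intro exI[of _ x]) simp
  qed
  then obtain x where x: "x < s" "alternation T1 (Suc n) (\<lambda>x. - m x) x" by blast
  obtain t where t: "t \<in> {s<..<d}" "m t > 0"
    using upward_point_right Suc.prems(4,5) by (metis s_def)
  then have "alternation T1 (Suc (Suc n)) m t"
    using x unfolding alternation.simps(2)[of _ "Suc n"]
    by (auto simp del: alternation.simps intro!: exI[of _ x])
  then show ?case using t unfolding s_def by blast
qed

lemma simple_change_points_alternates: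
  assumes "finite S" "card S = Suc n" "\<And>s. s \<in> S \<Longrightarrow> simple_change_point m T1 T2 s"
  shows "alternates T1 T2 (Suc n) m \<or> alternates T1 T2 (Suc n) (\<lambda>x. - m x)"
proof -
  have "Max S \<in> S" using assms by (auto intro!: Max_in)
  then have "simple_change_point m T1 T2 (Max S)" using assms by blast
  then have "Max S < T2" "upward_point T1 m (Max S) \<or> upward_point T1 (\<lambda>x. - m x) (Max S)"
    by (simp add: simple_change_point_def) (use \<open>simple_change_point m T1 T2 (Max S)\<close> in \<open>rule simple_change_point_imp_upward\<close>)
  then show ?thesis
    using simple_change_points_alternation[of S n m T1 T2 T2]
      simple_change_points_alternation[of S n "\<lambda>x. - m x" T1 T2 T2] assms
    by (auto simp del: alternation.simps simp: alternates_def simple_change_point_uminus)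
qed

section \<open>From alternations to points of change of sign\<close>

text \<open>\<open>s\<close> is where \<open>m\<close> first becomes positive after
  \<open>c\<close>, and \<open>s'\<close> is where it last was negative before that. By this choice
  \<open>m\<close> is nonpositive to the left of \<open>s\<close>; only immediately to the right of
  \<open>s\<close> could it oscillate, and there the absence of multiple points is used.\<close>

lemma simple_change_point_between:
  assumes cont: "continuous_on {T1..T2} m" and "T1 \<le> c" "c < d" "d \<le> T2" "m c < 0" "m d > 0"
    and nomult: "\<And>s. \<not> multiple_change_point m T1 T2 s"
  shows "\<exists>s\<in>{c<..<d}. simple_change_point m T1 T2 s"
proof -
  have contcd: "continuous_on {c..d} m"
    using cont by (rule continuous_on_subset) (use assms in auto)
  define P where "P = {x\<in>{c..d}. m x > 0}"
  define s where "s = Inf P"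
  have P: "d \<in> P" "bdd_below P" using assms by (auto simp: P_def intro!: bdd_belowI[of _ c])
  have sd: "s \<le> d" using P by (auto simp: s_def intro: cInf_lower)
  have cs: "c \<le> s" unfolding s_def by (rule cInf_greatest) (use P in \<open>auto simp: P_def\<close>)
  have left: "m t \<le> 0" if "c \<le> t" "t < s" for t
  proof (rule ccontr)
    assume "\<not> m t \<le> 0"
    then have "t \<in> P" using that sd by (auto simp: P_def)
    then show False using cInf_lower[OF _ P(2), of t] that by (simp add: s_def)
  qed
  have right: "\<exists>t\<in>P. t < y" if "s < y" for y
    using that P unfolding s_def by (subst (asm) cInf_less_iff) auto
  have ms0: "m s \<ge> 0"
  proof (rule ccontr)
    assume "\<not> m s \<ge> 0"
    then obtain e where "e > 0" "\<And>x. x \<in> {c..d} \<Longrightarrow> dist x s < e \<Longrightarrow> dist (m x) (m s) < - m s"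
      using contcd cs sd unfolding continuous_on_iff by (metis atLeastAtMost_iff neg_0_less_iff_less not_le)
    moreover obtain t where "t \<in> P" "t < s + e" using right[of "s+e"] \<open>e > 0\<close> by auto
    moreover have "t \<ge> s" using cInf_lower[OF _ P(2)] \<open>t \<in> P\<close> by (simp add: s_def)
    ultimately have "dist (m t) (m s) < - m s" "m t > 0" by (auto simp: P_def dist_real_def)
    then show False by (auto simp: dist_real_def)
  qed
  then have cs': "c < s" using cs \<open>m c < 0\<close> by (cases "c = s") auto
  have ms1: "m s \<le> 0"
  proof (rule ccontr)
    assume "\<not> m s \<le> 0"
    then obtain e where e: "e > 0" "\<And>x. x \<in> {c..d} \<Longrightarrow> dist x s < e \<Longrightarrow> dist (m x) (m s) < m s"
      using contcd cs sd unfolding continuous_on_iff by (metis atLeastAtMost_iff not_le)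
    define t where "t = max c (s - e/2)"
    have "t \<in> {c..d}" "dist t s < e" "c \<le> t" "t < s"
      using e cs' sd by (auto simp: t_def dist_real_def)
    with e(2)[of t] left[of t] show False by (auto simp: dist_real_def)
  qed
  have ms: "m s = 0" using ms0 ms1 by simp
  have sd': "s < d" using ms sd assms by (cases "s = d") auto
  have sP: "t > s" if "t \<in> P" for t
    using cInf_lower[OF that P(2)] that ms by (cases "t = s") (auto simp: s_def P_def)
  define Z where "Z = {x\<in>{c..s}. m x < 0}"
  define s' where "s' = Sup Z"
  have Z: "c \<in> Z" "bdd_above Z" using assms cs by (auto simp: Z_def intro!: bdd_aboveI[of _ s])
  have s's: "s' \<le> s" unfolding s'_def by (rule cSup_least) (use Z in \<open>auto simp: Z_def\<close>)
  have cs'': "c \<le> s'" unfolding s'_def by (rule cSup_upper) (use Z in auto)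
  have zero: "m t = 0" if "s' < t" "t \<le> s" for t
  proof (rule ccontr)
    assume "m t \<noteq> 0"
    then have "t \<in> Z" using that left[of t] cs'' ms by (cases "t = s") (auto simp: Z_def)
    then show False using cSup_upper[OF _ Z(2), of t] that by (simp add: s'_def)
  qed
  have near: "\<exists>t\<in>Z. y < t" if "y < s'" for y
    using that Z unfolding s'_def by (subst (asm) less_cSup_iff) auto
  have ms': "m s' = 0"
  proof (rule ccontr)
    assume "m s' \<noteq> 0"
    then have "m s' < 0" using left[of s'] ms s's cs'' by (cases "s' = s") auto
    then have "s' < s" using ms s's by (cases "s' = s") auto
    obtain e where e: "e > 0" "\<And>x. x \<in> {c..d} \<Longrightarrow> dist x s' < e \<Longrightarrow> dist (m x) (m s') < - m s'"
      using contcd cs'' s's sd \<open>m s' < 0\<close> unfolding continuous_on_iff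
      by (metis atLeastAtMost_iff neg_0_less_iff_less order_trans)
    define t where "t = min s (s' + e/2)"
    have "t \<in> {c..d}" "dist t s' < e" "s' < t" "t \<le> s"
      using e cs'' sd \<open>s' < s\<close> cs by (auto simp: t_def dist_real_def)
    with e(2)[of t] zero[of t] show False by (auto simp: dist_real_def)
  qed
  then have cs3: "c < s'" using cs'' \<open>m c < 0\<close> by (cases "c = s'") auto
  have "\<not> (s < T2 \<and> (\<forall>e>0. changes_sign_on m ({s<..<s+e} \<inter> {T1..T2})))"
    using nomult[of s] cs' sd' assms unfolding multiple_change_point_def by auto
  then obtain e1 where e1: "e1 > 0" "\<not> changes_sign_on m ({s<..<s+e1} \<inter> {T1..T2})"
    using sd' assms by auto
  \<comment> \<open>\<open>e1\<close> excludes negative values just after \<open>s\<close>, where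
    positive ones accumulate; the other two bounds keep both windows inside
    \<open>[c, d]\<close>.\<close>
  define e0 where "e0 = Min {e1, s' - c, d - s}"
  have e0: "e0 > 0" "e0 \<le> e1" "e0 \<le> s' - c" "e0 \<le> d - s" using e1 cs3 sd' by (auto simp: e0_def)
  have nonneg: "m t \<ge> 0" if "t \<in> {s<..<s+e0}" for t
  proof (rule ccontr)
    assume "\<not> m t \<ge> 0"
    moreover have "t \<in> {s<..<s+e1} \<inter> {T1..T2}" using that e0 assms cs' by auto
    moreover obtain x where "x \<in> P" "x < s+e0" using right[of "s+e0"] e0 by auto
    moreover have "x \<in> {s<..<s+e1} \<inter> {T1..T2}" using sP[of x] calculation e0 assms by (auto simp: P_def)
    ultimately show False using e1(2) unfolding changes_sign_on_iff P_def
      by (metis (no_types, lifting) mem_Collect_eq not_le)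
  qed
  have "simple_change_point m T1 T2 s"
    unfolding simple_change_point_def
  proof (rule conjI, use cs' sd' assms in force, rule exI[of _ s'], rule exI[of _ e0],
      intro conjI disjI1 allI impI)
    show "T1 < s'" "s' \<le> s" "0 < e0" using cs' sd' cs3 s's e0 assms by auto
    fix e assume e: "0 < e \<and> e < e0"
    show "\<forall>t\<in>{s' - e<..<s'}. m t \<le> 0" using left s's e e0 by auto
    show "\<forall>t\<in>{s'..s}. m t = 0" using zero ms' by (metis atLeastAtMost_iff order_le_less)
    show "\<forall>t\<in>{s<..<s+e}. 0 \<le> m t" using nonneg e by auto
    obtain x where x: "x \<in> P" "x < s+e" using right[of "s+e"] e by auto
    then show "nonzero_on m {s<..<s+e}"
      unfolding nonzero_on_def using sP by (intro bexI[of _ x]) (auto simp: P_def)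
    obtain y where y: "y \<in> Z" "s' - e < y" using near[of "s'-e"] e by auto
    moreover have "y \<le> s'" using cSup_upper[OF y(1) Z(2)] by (simp add: s'_def)
    moreover have "y \<noteq> s'" using y ms' by (auto simp: Z_def)
    ultimately show "nonzero_on m {s'-e<..<s'}"
      unfolding nonzero_on_def by (intro bexI[of _ y]) (auto simp: Z_def)
  qed
  then show ?thesis using cs' sd' by auto
qed

lemma alternation_simple_change_points:
  assumes "continuous_on {T1..T2} m" "\<And>s. \<not> multiple_change_point m T1 T2 s"
    and "alternation T1 k m t" "t < T2"
  shows "\<exists>S. finite S \<and> card S = k \<and> (\<forall>s\<in>S. simple_change_point m T1 T2 s \<and> s < t)"
  using assms
proof (induction k arbitrary: m t)
  case 0
  then show ?case by (intro exI[of _ "{}"]) auto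
next
  case (Suc k)
  then obtain r where r: "r < t" "alternation T1 k (\<lambda>x. - m x) r" "m t > 0" by auto
  have "\<exists>S. finite S \<and> card S = k \<and> (\<forall>s\<in>S. simple_change_point (\<lambda>x. - m x) T1 T2 s \<and> s < r)"
    using Suc.prems r by (intro Suc.IH) (auto intro!: continuous_on_minus simp: multiple_change_point_uminus)
  then obtain S where S: "finite S" "card S = k" "\<forall>s\<in>S. simple_change_point m T1 T2 s \<and> s < r"
    by (auto simp: simple_change_point_uminus)
  obtain s where "s \<in> {r<..<t}" "simple_change_point m T1 T2 s"
    using simple_change_point_between[OF Suc.prems(1), of r t] r Suc.prems(2,4)
      alternation_pos[OF r(2)] alternation_gt[OF r(2)] by auto
  moreover from this S r have "s \<notin> S" by auto
  ultimately show ?case using S r by (intro exI[of _ "insert s S"]) auto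
qed

section \<open>Counting the indices of alternations\<close>

lemma alternates_le_num_sign_changes:
  assumes "continuous_on {T1..T2} m" "alternates T1 T2 k m"
  shows "enat k \<le> num_sign_changes m T1 T2"
proof (cases "\<exists>s. multiple_change_point m T1 T2 s")
  case False
  obtain t where "t < T2" "alternation T1 k m t" using assms by (auto simp: alternates_def)
  with False obtain S where "finite S" "card S = k" "\<forall>s\<in>S. simple_change_point m T1 T2 s"
    using alternation_simple_change_points[OF assms(1), of k t] by blast
  then show ?thesis using False card_mono[of "{s. simple_change_point m T1 T2 s}" S]
    by (auto simp: num_sign_changes_def ecard_def)
qed (simp add: num_sign_changes_def)

lemma num_sign_changes_uminus: "num_sign_changes (\<lambda>x. - m x) T1 T2 = num_sign_changes m T1 T2"
  unfolding num_sign_changes_def simple_change_point_uminus multiple_change_point_uminus ..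

lemma le_num_sign_changes_alternates:
  assumes "enat (Suc n) \<le> num_sign_changes m T1 T2"
  shows "alternates T1 T2 (Suc n) m \<or> alternates T1 T2 (Suc n) (\<lambda>x. - m x)"
proof (cases "\<exists>s. multiple_change_point m T1 T2 s")
  case True
  then show ?thesis using multiple_change_point_alternates by blast
next
  case False
  let ?A = "{s. simple_change_point m T1 T2 s}"
  have "\<exists>S\<subseteq>?A. finite S \<and> card S = Suc n"
  proof (cases "finite ?A")
    case True
    then have "Suc n \<le> card ?A" using assms False by (simp add: num_sign_changes_def ecard_def)
    then show ?thesis using True by (meson obtain_subset_with_card_n)
  next
    case False
    then show ?thesis using infinite_arbitrarily_large by blast
  qed
  then show ?thesis using simple_change_points_alternates[of _ n m T1 T2] by auto
qed

lemma ecard_alternates: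
  assumes cont: "continuous_on {T1..T2} m" and ch: "changes_sign_on m {T1<..<T2}"
  defines "N \<equiv> num_sign_changes m T1 T2"
  shows "1 \<le> N"
    and "ecard {k. 1 \<le> k \<and> alternates T1 T2 k m}
       + ecard {k. 1 \<le> k \<and> alternates T1 T2 k (\<lambda>x. - m x)} = 2 * N - 1"
proof -
  obtain s t where st: "s \<in> {T1<..<T2}" "m s > 0" "t \<in> {T1<..<T2}" "m t < 0"
    using ch by (auto simp: changes_sign_on_iff)
  have le: "enat k \<le> N" if "alternates T1 T2 k m \<or> alternates T1 T2 k (\<lambda>x. - m x)" for k
    using that alternates_le_num_sign_changes[OF cont]
      alternates_le_num_sign_changes[OF continuous_on_minus[OF cont]]
    by (auto simp: N_def num_sign_changes_uminus)
  have "alternates T1 T2 0 m" "alternates T1 T2 0 (\<lambda>x. - m x)"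
    using st by (auto simp: alternates_def)
  from alternates_both[OF this] le[of 1] show N1: "1 \<le> N" by (simp add: one_enat_def)
  let ?A = "\<lambda>m. {k. 1 \<le> k \<and> alternates T1 T2 k m}"
  show "ecard (?A m) + ecard (?A (\<lambda>x. - m x)) = 2 * N - 1"
  proof (cases N)
    case infinity
    have "alternates T1 T2 k m \<and> alternates T1 T2 k (\<lambda>x. - m x)" for k
      using le_num_sign_changes_alternates[of k m T1 T2] infinity alternates_Suc_imp[of T1 T2 k]
        alternates_Suc_imp_uminus[of T1 T2 k m] alternates_Suc_imp_uminus[of T1 T2 k "\<lambda>x. - m x"]
      by (auto simp: N_def)
    \<comment> \<open>One infinite summand suffices, as it absorbs the other.\<close>
    then have "?A m = {1..}" by auto
    then show ?thesis using infinity infinite_Ici[of "1::nat"] by (simp add: ecard_def numeral_eq_enat one_enat_def)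
  next
    case (enat n)
    then obtain j where n: "n = Suc j" using N1 by (cases n) (auto simp: one_enat_def)
    \<comment> \<open>\<open>f\<close> is whichever of \<open>m\<close> and \<open>- m\<close>
      alternates with the maximal index \<open>n = Suc j\<close>; the other one then stops at
      \<open>j\<close>, giving \<open>n + j = 2 * n - 1\<close>.\<close>
    have key: "ecard (?A f) = enat n \<and> ecard (?A g) = enat j"
      if f: "alternates T1 T2 n f" and fg: "g = (\<lambda>x. - f x)" and
       le: "\<And>k. alternates T1 T2 k f \<or> alternates T1 T2 k g \<Longrightarrow> k \<le> n" for f g
    proof -
      have "?A f = {1..n}" using alternates_mono[OF f] le by auto
      moreover have "\<not> alternates T1 T2 n g"
        using alternates_both[of T1 T2 n f] f fg le[of "Suc n"] by auto
      moreover have "alternates T1 T2 j g" using f fg n alternates_Suc_imp_uminus by blast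
      ultimately have "?A f = {1..n}" "?A g = {1..j}"
        using alternates_mono[of T1 T2 j g] le n by (auto simp: le_Suc_eq)
      then show ?thesis by (simp add: ecard_def)
    qed
    have "alternates T1 T2 n m \<or> alternates T1 T2 n (\<lambda>x. - m x)"
      using le_num_sign_changes_alternates[of j m T1 T2] n enat by (simp add: N_def)
    then have "ecard (?A m) + ecard (?A (\<lambda>x. - m x)) = enat (n + j)"
    proof
      assume "alternates T1 T2 n m"
      from key[OF this refl] le enat show ?thesis by simp
    next
      assume "alternates T1 T2 n (\<lambda>x. - m x)"
      from key[OF this, of m] le enat have "ecard (?A (\<lambda>x. - m x)) = enat n \<and> ecard (?A m) = enat j"
        by (simp add: disj_commute)
      then show ?thesis by simp
    qed
    also have "\<dots> = 2 * N - 1" by (simp add: enat n one_enat_def numeral_eq_enat)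
    finally show ?thesis .
  qed
qed

section \<open>Scalar differential equations\<close>

text \<open>A one-sided Gronwall argument: after the last time with \<open>f \<le> 0\<close>, the
  function \<open>exp (- K * t) * f t\<close> cannot increase. Asking for the inequality only where
  \<open>f > 0\<close> turns it into a comparison principle, because the sign of the difference is
  then known when a Lipschitz bound is applied.\<close>

lemma subsolution_nonpos:
  fixes f :: "real \<Rightarrow> real"
  assumes "a \<le> b" and cont: "continuous_on {a..b} f" and "f a \<le> 0"
    and der: "\<And>t. a < t \<Longrightarrow> t < b \<Longrightarrow> f t > 0 \<Longrightarrow> \<exists>d. (f has_real_derivative d) (at t) \<and> d \<le> K * f t"
  shows "f b \<le> 0"
proof (rule ccontr)
  assume "\<not> f b \<le> 0"
  define P where "P = {a..b} \<inter> f -` {..0}"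
  have "compact P"
    unfolding P_def compact_eq_bounded_closed
    using continuous_closed_preimage[OF cont, of "{..0}"] by (auto intro: bounded_subset[of "{a..b}"])
  moreover have "P \<noteq> {}" using assms by (auto simp: P_def)
  ultimately have "\<exists>s\<in>P. \<forall>t\<in>P. t \<le> s" by (rule compact_attains_sup)
  then obtain s where s: "s \<in> P" "\<And>t. t \<in> P \<Longrightarrow> t \<le> s" by blast
  then have fs: "f s \<le> 0" "a \<le> s" "s < b" using \<open>\<not> f b \<le> 0\<close> by (auto simp: P_def less_le)
  have pos: "f t > 0" if "s < t" "t \<le> b" for t
  proof (rule ccontr)
    assume "\<not> f t > 0"
    then have "t \<in> P" using that fs by (auto simp: P_def)
    then show False using s(2)[of t] that by simp
  qed
  have "exp (- K * b) * f b \<le> exp (- K * s) * f s"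
  proof (rule DERIV_nonpos_imp_decreasing_open[of s b "\<lambda>t. exp (- K * t) * f t"])
    show "s \<le> b" using fs by simp
    show "continuous_on {s..b} (\<lambda>t. exp (- K * t) * f t)"
      by (intro continuous_intros continuous_on_subset[OF cont]) (use fs in auto)
    fix t assume t: "s < t" "t < b"
    then obtain d where d: "(f has_real_derivative d) (at t)" "d \<le> K * f t"
      using der[of t] pos[of t] fs by auto
    have "((\<lambda>t. exp (- K * t) * f t) has_real_derivative exp (- K * t) * (d - K * f t)) (at t)"
      by (auto intro!: derivative_eq_intros d(1) simp: algebra_simps)
    moreover have "exp (- K * t) * (d - K * f t) \<le> 0"
      using d(2) by (simp add: mult_le_0_iff)
    ultimately show "\<exists>y. ((\<lambda>t. exp (- K * t) * f t) has_real_derivative y) (at t) \<and> y \<le> 0" by blast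
  qed
  also have "\<dots> \<le> 0" using fs(1) by (simp add: mult_le_0_iff)
  finally show False using \<open>\<not> f b \<le> 0\<close> by (simp add: mult_le_0_iff)
qed

lemma supersolution_nonpos:
  fixes f :: "real \<Rightarrow> real"
  assumes "a \<le> b" and cont: "continuous_on {a..b} f" and "f b \<le> 0"
    and der: "\<And>t. a < t \<Longrightarrow> t < b \<Longrightarrow> f t > 0 \<Longrightarrow> \<exists>d. (f has_real_derivative d) (at t) \<and> - K * f t \<le> d"
  shows "f a \<le> 0"
proof -
  have "(\<lambda>t. f (- t)) (- a) \<le> 0"
  proof (rule subsolution_nonpos[of "- b" "- a" _ K])
    show "continuous_on {- b..- a} (\<lambda>t. f (- t))"
      by (rule continuous_on_compose2[OF cont]) (auto intro!: continuous_intros)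
    fix t assume "- b < t" "t < - a" "f (- t) > 0"
    then obtain d where d: "(f has_real_derivative d) (at (- t))" "- K * f (- t) \<le> d"
      using der[of "- t"] by auto
    have "((\<lambda>t. f (- t)) has_real_derivative - d) (at t)"
      using DERIV_mirror[where f = f and x = t and y = d] d(1) by simp
    then show "\<exists>d. ((\<lambda>t. f (- t)) has_real_derivative d) (at t) \<and> d \<le> K * f (- t)"
      using d(2) by (intro exI[of _ "- d"]) auto
  qed (use assms in auto)
  then show ?thesis by simp
qed

text \<open>
  Picard iteration: with the weight \<open>exp (- K (t - T1))\<close>, \<open>K = 2 L\<close>, the integral operator is a
  contraction on all of \<open>[T1, T2]\<close>, so no continuation argument is needed.
\<close>

lemma lipschitz_ode_solution_exists:
  fixes F :: "real \<Rightarrow> real \<Rightarrow> real"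
  assumes "T1 < T2" and cont: "continuous_on ({T1..T2} \<times> UNIV) (\<lambda>(t, x). F t x)"
    and "L > 0" and lip: "\<And>t x y. t \<in> {T1..T2} \<Longrightarrow> \<bar>F t x - F t y\<bar> \<le> L * \<bar>x - y\<bar>"
  shows "\<exists>x. x T1 = x0 \<and> (\<forall>t\<in>{T1..T2}. (x has_real_derivative F t (x t)) (at t within {T1..T2}))"
proof -
  define K where "K = 2 * L"
  \<comment> \<open>The fixed point \<open>y\<close> stands for
    \<open>exp (- K * (t - T1)) * x t\<close>, so \<open>G\<close> removes the weight before
    \<open>F\<close> is applied. The clamp \<open>c\<close> extends functions from
    \<open>{T1..T2}\<close> to the whole line, the domain of \<open>bcontfun\<close>.\<close>
  define c where "c t = max T1 (min T2 t)" for t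
  define G where "G y s = F s (exp (K * (s - T1)) * apply_bcontfun y s)" for y s
  define I where "I y t = x0 + integral {T1..t} (G y)" for y t
  define \<Phi> where "\<Phi> y t = exp (- K * (c t - T1)) * I y (c t)" for y t
  have c: "c t \<in> {T1..T2}" for t using \<open>T1 < T2\<close> by (auto simp: c_def)
  have contG: "continuous_on {T1..T2} (G y)" for y
    unfolding G_def
    by (rule continuous_on_compose2[OF cont, of _ "\<lambda>s. (s, exp (K * (s - T1)) * apply_bcontfun y s)", unfolded split_conv])
      (auto intro!: continuous_intros)
  have derI: "(I y has_real_derivative G y t) (at t within {T1..T2})" if "t \<in> {T1..T2}" for y t
    unfolding I_def using integral_has_real_derivative[OF contG that, of y]
    by (auto intro!: derivative_eq_intros)
  have contI: "continuous_on {T1..T2} (I y)" for y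
    using derI DERIV_continuous_on by blast
  have "\<Phi> y \<in> bcontfun" for y
  proof -
    let ?f = "\<lambda>r. exp (- K * (r - T1)) * I y r"
    have *: "continuous_on {T1..T2} ?f" by (intro continuous_intros contI)
    then have "continuous_on UNIV (\<lambda>t. ?f (c t))"
      by (rule continuous_on_compose2) (use c in \<open>auto simp: c_def intro!: continuous_intros\<close>)
    moreover have "bounded (?f ` {T1..T2})"
      using * by (intro compact_imp_bounded compact_continuous_image) auto
    then have "bounded (range (\<lambda>t. ?f (c t)))"
      by (rule bounded_subset) (use c in auto)
    ultimately show ?thesis by (simp add: bcontfun_def \<Phi>_def[abs_def])
  qed
  then have apply\<Phi>: "apply_bcontfun (Bcontfun (\<Phi> y)) = \<Phi> y" for y
    by (rule Bcontfun_inverse)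
  have "dist (Bcontfun (\<Phi> y)) (Bcontfun (\<Phi> z)) \<le> 1/2 * dist y z" for y z
  proof (rule dist_bound)
    fix t
    define r D where "r = c t" and "D = dist y z"
    have r: "T1 \<le> r" "r \<le> T2" using c[of t] by (auto simp: r_def)
    have sub: "{T1..r} \<subseteq> {T1..T2}" using r by auto
    have int: "G y integrable_on {T1..r}" for y
      by (rule integrable_continuous_real) (rule continuous_on_subset[OF contG sub])
    have hi: "((\<lambda>s. L * D * exp (K * (s - T1))) has_integral
        L * D * exp (K * (r - T1)) / K - L * D * exp (K * (T1 - T1)) / K) {T1..r}"
      by (rule fundamental_theorem_of_calculus[OF r(1)])
        (use \<open>L > 0\<close> in \<open>auto simp: has_real_derivative_iff_has_vector_derivative[symmetric] K_def
          intro!: derivative_eq_intros\<close>)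
    have "\<bar>integral {T1..r} (\<lambda>s. G y s - G z s)\<bar> \<le> integral {T1..r} (\<lambda>s. L * D * exp (K * (s - T1)))"
      unfolding real_norm_def[symmetric]
    proof (rule integral_norm_bound_integral)
      show "(\<lambda>s. G y s - G z s) integrable_on {T1..r}" by (intro integrable_diff int)
      show "(\<lambda>s. L * D * exp (K * (s - T1))) integrable_on {T1..r}" using hi by blast
      fix s assume s: "s \<in> {T1..r}"
      have "\<bar>G y s - G z s\<bar> \<le> L * \<bar>exp (K * (s - T1)) * apply_bcontfun y s - exp (K * (s - T1)) * apply_bcontfun z s\<bar>"
        unfolding G_def using s sub by (intro lip) auto
      also have "\<dots> = L * exp (K * (s - T1)) * dist (apply_bcontfun y s) (apply_bcontfun z s)"
        by (simp add: dist_real_def abs_mult flip: right_diff_distrib)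
      also have "\<dots> \<le> L * exp (K * (s - T1)) * D"
        unfolding D_def using \<open>L > 0\<close> by (intro mult_left_mono dist_bounded) auto
      finally show "norm (G y s - G z s) \<le> L * D * exp (K * (s - T1))" by (simp add: mult_ac)
    qed
    also have "\<dots> = D / 2 * (exp (K * (r - T1)) - 1)"
      using integral_unique[OF hi] \<open>L > 0\<close> by (simp add: K_def field_simps)
    also have "\<dots> \<le> D / 2 * exp (K * (r - T1))"
      by (intro mult_left_mono) (auto simp: D_def)
    finally have *: "\<bar>integral {T1..r} (\<lambda>s. G y s - G z s)\<bar> \<le> D / 2 * exp (K * (r - T1))" .
    have "dist (\<Phi> y t) (\<Phi> z t) = exp (- K * (r - T1)) * \<bar>integral {T1..r} (\<lambda>s. G y s - G z s)\<bar>"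
      by (simp add: \<Phi>_def I_def r_def[symmetric] dist_real_def integral_diff[OF int int] abs_mult
          flip: right_diff_distrib)
    also have "\<dots> \<le> exp (- K * (r - T1)) * (D / 2 * exp (K * (r - T1)))"
      by (intro mult_left_mono *) auto
    also have "\<dots> = D / 2" by (simp add: exp_minus)
    finally show "dist (apply_bcontfun (Bcontfun (\<Phi> y)) t) (apply_bcontfun (Bcontfun (\<Phi> z)) t) \<le> 1/2 * dist y z"
      by (simp add: apply\<Phi> D_def)
  qed
  then obtain y where "Bcontfun (\<Phi> y) = y"
    using banach_fix_type[of "1/2" "\<lambda>y. Bcontfun (\<Phi> y)"] by auto
  then have y: "apply_bcontfun y = \<Phi> y" using apply\<Phi>[of y] by simp
  have "G y t = F t (I y t)" if "t \<in> {T1..T2}" for t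
  proof -
    have "c t = t" using that by (auto simp: c_def)
    then have "exp (K * (t - T1)) * apply_bcontfun y t = I y t"
      unfolding y by (simp add: \<Phi>_def exp_minus)
    then show ?thesis by (simp add: G_def)
  qed
  then have "\<forall>t\<in>{T1..T2}. (I y has_real_derivative F t (I y t)) (at t within {T1..T2})"
    using derI[of _ y] by simp
  moreover have "I y T1 = x0" by (simp add: I_def)
  ultimately show ?thesis by blast
qed

section \<open>Nodal intervals of solutions\<close>

locale sturm_liouville =
  fixes T1 T2 :: real and p q :: "real \<Rightarrow> real"
  assumes T12: "T1 < T2"
    and cont_p: "continuous_on {T1..T2} p" and cont_q: "continuous_on {T1..T2} q"
    and p_pos: "\<And>t. t \<in> {T1..T2} \<Longrightarrow> p t > 0"
    and q_nonneg: "\<And>t. t \<in> {T1..T2} \<Longrightarrow> q t \<ge> 0"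
begin

text \<open>The equation as a first-order system for \<open>u\<close> and the flux
  \<open>v = p u'\<close>, the form in which it makes sense for a merely continuous
  \<open>p\<close>.\<close>

definition solves :: "(real \<Rightarrow> real) \<Rightarrow> real \<Rightarrow> real \<Rightarrow> (real \<Rightarrow> real) \<Rightarrow> (real \<Rightarrow> real) \<Rightarrow> bool" where
  "solves m a b u v \<longleftrightarrow> continuous_on {T1..T2} u \<and> continuous_on {T1..T2} v \<and>
     (\<forall>t\<in>{T1<..<T2}. (u has_real_derivative v t / p t) (at t) \<and>
       (v has_real_derivative q t * u t - m t * (a * pos_part u t - b * neg_part u t)) (at t))"

text \<open>Negating \<open>u\<close> exchanges its positive and negative parts. The new pair
  \<open>(- b, - a)\<close> lies in the same quadrant \<open>0 \<le> a\<close>,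
  \<open>b \<le> 0\<close>, so an induction over nodal intervals can be repeated with
  \<open>- m\<close>.\<close>

lemma solves_uminus:
  assumes "solves m a b u v"
  shows "solves (\<lambda>x. - m x) (- b) (- a) (\<lambda>x. - u x) (\<lambda>x. - v x)"
proof -
  have "q t * - u t - - m t * (- b * pos_part (\<lambda>x. - u x) t - - a * neg_part (\<lambda>x. - u x) t) =
      - (q t * u t - m t * (a * pos_part u t - b * neg_part u t))" for t
    by (simp add: pos_part_def neg_part_def algebra_simps)
  moreover have "((\<lambda>x. - u x) has_real_derivative - v t / p t) (at t)"
    if "(u has_real_derivative v t / p t) (at t)" for t
    using DERIV_minus[OF that] by simp
  moreover note DERIV_minus[of v]
  ultimately show ?thesis
    using assms unfolding solves_def by (metis continuous_on_minus)
qed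

lemma neumann_solution_solves:
  assumes "neumann_solution p q m T1 T2 a b u"
  obtains v where "solves m a b u v" "v T1 = 0" "v T2 = 0"
proof -
  from assms obtain u' where u': "continuous_on {T1..T2} u'"
    "\<And>t. t \<in> {T1..T2} \<Longrightarrow> (u has_real_derivative u' t) (at t within {T1..T2})"
    "\<And>t. t \<in> {T1<..<T2} \<Longrightarrow> \<exists>w. ((\<lambda>s. p s * u' s) has_real_derivative w) (at t)
              \<and> - w + q t * u t = m t * (a * pos_part u t - b * neg_part u t)"
    "u' T1 = 0" "u' T2 = 0"
    unfolding neumann_solution_def by blast
  have "solves m a b u (\<lambda>s. p s * u' s)"
    unfolding solves_def
  proof (intro conjI ballI)
    show "continuous_on {T1..T2} u" using u'(2) DERIV_continuous_on by blast
    show "continuous_on {T1..T2} (\<lambda>s. p s * u' s)" by (intro continuous_intros cont_p u')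
    fix t assume t: "t \<in> {T1<..<T2}"
    then have "(u has_real_derivative u' t) (at t)"
      using u'(2)[of t] at_within_Icc_at[of T1 t T2] by simp
    then show "(u has_real_derivative p t * u' t / p t) (at t)" using p_pos[of t] t by simp
    obtain w where w: "((\<lambda>s. p s * u' s) has_real_derivative w) (at t)"
      "- w + q t * u t = m t * (a * pos_part u t - b * neg_part u t)" using u'(3)[OF t] by blast
    have "w = q t * u t - m t * (a * pos_part u t - b * neg_part u t)" using w(2) by linarith
    then show "((\<lambda>s. p s * u' s) has_real_derivative q t * u t - m t * (a * pos_part u t - b * neg_part u t)) (at t)"
      using w(1) by simp
  qed
  then show thesis using that u' by simp
qed

lemma bounded_coefficient:
  assumes "continuous_on {T1..T2} (f :: real \<Rightarrow> real)"
  obtains M where "M > 0" "\<And>t. t \<in> {T1..T2} \<Longrightarrow> \<bar>f t\<bar> \<le> M"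
proof -
  have "bounded (f ` {T1..T2})"
    using assms by (intro compact_imp_bounded compact_continuous_image) auto
  then show thesis using that by (auto simp: bounded_pos)
qed

lemma cont_inverse_p: "continuous_on {T1..T2} (\<lambda>t. 1 / p t)"
  using p_pos by (intro continuous_intros cont_p) (auto simp: less_imp_neq[symmetric])

text \<open>Zeros of a nontrivial solution are simple: the energy \<open>u^2 + v^2\<close> satisfies
  \<open>abs E' \<le> K * E\<close>, so if it vanishes at one point, it vanishes on both sides of
  it.\<close>

lemma solves_eq_0:
  assumes m: "continuous_on {T1..T2} m" and uv: "solves m a b u v"
    and z: "z \<in> {T1..T2}" "u z = 0" "v z = 0" and x: "x \<in> {T1..T2}"
  shows "u x = 0"
proof -
  have cont: "continuous_on {T1..T2} u" "continuous_on {T1..T2} v" using uv by (auto simp: solves_def)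
  \<comment> \<open>Chosen so that \<open>abs E' \<le> 2 * abs u * abs v * B\<close>, and the
    product in front of \<open>B\<close> is at most \<open>E\<close>.\<close>
  define B where "B t = 1 / p t + q t + \<bar>m t\<bar> * (\<bar>a\<bar> + \<bar>b\<bar>)" for t
  have "continuous_on {T1..T2} B" unfolding B_def
    by (intro continuous_intros cont_inverse_p cont_q m)
  then obtain K where K: "K > 0" "\<And>t. t \<in> {T1..T2} \<Longrightarrow> \<bar>B t\<bar> \<le> K" using bounded_coefficient by blast
  define E where "E t = (u t)\<^sup>2 + (v t)\<^sup>2" for t
  have contE: "continuous_on {T1..T2} E" unfolding E_def by (intro continuous_intros cont)
  have der: "\<exists>d. (E has_real_derivative d) (at t) \<and> \<bar>d\<bar> \<le> K * E t" if t: "t \<in> {T1<..<T2}" for t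
  proof -
    define f where "f = m t * (a * pos_part u t - b * neg_part u t)"
    define d where "d = 2 * u t * (v t / p t) + 2 * v t * (q t * u t - f)"
    have "(u has_real_derivative v t / p t) (at t)" "(v has_real_derivative q t * u t - f) (at t)"
      using uv t by (auto simp: solves_def f_def)
    then have 1: "(E has_real_derivative d) (at t)"
      unfolding E_def d_def by (auto intro!: derivative_eq_intros)
    have "\<bar>a * pos_part u t - b * neg_part u t\<bar> \<le> \<bar>a * pos_part u t\<bar> + \<bar>b * neg_part u t\<bar>" by linarith
    also have "\<dots> \<le> \<bar>a\<bar> * \<bar>u t\<bar> + \<bar>b\<bar> * \<bar>u t\<bar>"
      unfolding abs_mult by (intro add_mono mult_left_mono) (auto simp: pos_part_def neg_part_def)
    finally have "\<bar>a * pos_part u t - b * neg_part u t\<bar> \<le> (\<bar>a\<bar> + \<bar>b\<bar>) * \<bar>u t\<bar>"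
      by (simp add: distrib_right)
    from mult_left_mono[OF this abs_ge_zero[of "m t"]]
    have f: "\<bar>f\<bar> \<le> \<bar>m t\<bar> * (\<bar>a\<bar> + \<bar>b\<bar>) * \<bar>u t\<bar>"
      by (simp only: f_def abs_mult mult.assoc)
    have nn: "1 / p t \<ge> 0" "q t \<ge> 0" using p_pos[of t] q_nonneg[of t] t by auto
    have "\<bar>d\<bar> \<le> \<bar>2 * u t * (v t / p t)\<bar> + \<bar>2 * v t * (q t * u t - f)\<bar>" unfolding d_def by linarith
    also have "\<dots> = 2 * \<bar>v t\<bar> * (\<bar>u t\<bar> * (1 / p t)) + 2 * \<bar>v t\<bar> * \<bar>q t * u t - f\<bar>"
      using nn by (simp add: abs_mult)
    also have "\<dots> \<le> 2 * \<bar>v t\<bar> * (\<bar>u t\<bar> * (1 / p t)) + 2 * \<bar>v t\<bar> * (q t * \<bar>u t\<bar> + \<bar>m t\<bar> * (\<bar>a\<bar> + \<bar>b\<bar>) * \<bar>u t\<bar>)"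
    proof -
      have "\<bar>q t * u t - f\<bar> \<le> \<bar>q t * u t\<bar> + \<bar>f\<bar>" by linarith
      also have "\<bar>q t * u t\<bar> = q t * \<bar>u t\<bar>" using nn by (simp add: abs_mult)
      finally have "\<bar>q t * u t - f\<bar> \<le> q t * \<bar>u t\<bar> + \<bar>m t\<bar> * (\<bar>a\<bar> + \<bar>b\<bar>) * \<bar>u t\<bar>" using f by linarith
      then show ?thesis by (intro add_left_mono mult_left_mono) auto
    qed
    also have "\<dots> = (2 * \<bar>u t\<bar> * \<bar>v t\<bar>) * B t" by (simp add: B_def algebra_simps)
    also have "\<dots> \<le> E t * K"
    proof (rule mult_mono)
      show "2 * \<bar>u t\<bar> * \<bar>v t\<bar> \<le> E t"
        unfolding E_def using sum_squares_bound[of "\<bar>u t\<bar>" "\<bar>v t\<bar>"] by simp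
      show "B t \<le> K" using K(2)[of t] t by auto
      show "0 \<le> B t" unfolding B_def using nn by auto
    qed (auto simp: E_def)
    finally show ?thesis using 1 by (auto simp: mult.commute)
  qed
  have "E x \<le> 0"
  proof (cases "z \<le> x")
    case True
    show ?thesis
    proof (rule subsolution_nonpos[OF True, of E K])
      show "continuous_on {z..x} E" using contE by (rule continuous_on_subset) (use z x in auto)
      show "E z \<le> 0" using z by (simp add: E_def)
      fix t assume "z < t" "t < x"
      then show "\<exists>d. (E has_real_derivative d) (at t) \<and> d \<le> K * E t" using der[of t] z x by force
    qed
  next
    case False
    then have "x \<le> z" by simp
    then show ?thesis
    proof (rule supersolution_nonpos[of _ _ E K])
      show "continuous_on {x..z} E" using contE by (rule continuous_on_subset) (use z x in auto)
      show "E z \<le> 0" using z by (simp add: E_def)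
      fix t assume "x < t" "t < z"
      then show "\<exists>d. (E has_real_derivative d) (at t) \<and> - K * E t \<le> d" using der[of t] z x by force
    qed
  qed
  then show ?thesis by (simp add: E_def sum_power2_le_zero_iff)
qed

section \<open>Sign of the weight on nodal intervals\<close>

text \<open>Where \<open>u > 0\<close> only \<open>a\<close> enters and
  \<open>v' = (q - a m) u\<close>, with \<open>q\<close>, \<open>a\<close> and \<open>- m\<close>
  all nonnegative.\<close>

lemma solves_flux_mono:
  assumes uv: "solves m a b u v" and "0 \<le> a" and cd: "T1 \<le> c" "c < d" "d \<le> T2"
    and pos: "\<And>t. t \<in> {c<..<d} \<Longrightarrow> u t > 0" and m: "\<And>t. t \<in> {c<..<d} \<Longrightarrow> m t \<le> 0"
  shows "v c \<le> v d"
proof (rule DERIV_nonneg_imp_increasing_open[of c d v])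
  show "continuous_on {c..d} v"
    using uv unfolding solves_def by (meson atLeastatMost_subset_iff cd continuous_on_subset)
  fix t assume t: "c < t" "t < d"
  then have "(v has_real_derivative q t * u t - m t * (a * pos_part u t - b * neg_part u t)) (at t)"
    using uv cd by (auto simp: solves_def)
  moreover have "a * pos_part u t - b * neg_part u t = a * u t"
    using pos[of t] t by (auto simp: pos_part_def neg_part_def)
  moreover have "q t * u t \<ge> 0" using q_nonneg[of t] pos[of t] t cd by auto
  moreover have "m t * (a * u t) \<le> 0"
    using m[of t] pos[of t] t \<open>0 \<le> a\<close> by (auto intro!: mult_nonpos_nonneg)
  ultimately show "\<exists>y. (v has_real_derivative y) (at t) \<and> 0 \<le> y" by fastforce
qed (use cd in auto)

lemma no_zero_imp_pos:
  assumes u: "continuous_on {T1..T2} (u :: real \<Rightarrow> real)" and cd: "T1 \<le> c" "d \<le> T2"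
    and nz: "\<And>t. t \<in> {c<..<d} \<Longrightarrow> u t \<noteq> 0" and y: "y \<in> {c<..<d}" "u y > 0" and t: "t \<in> {c<..<d}"
  shows "u t > 0"
proof (rule ccontr)
  assume "\<not> u t > 0"
  then have ut: "u t \<le> 0" by simp
  have sub: "{min t y..max t y} \<subseteq> {c<..<d}" using y t by auto
  then have cont: "continuous_on {min t y..max t y} u"
    by (intro continuous_on_subset[OF u]) (use cd in auto)
  have "\<exists>x. min t y \<le> x \<and> x \<le> max t y \<and> u x = 0"
  proof (cases "t \<le> y")
    case True
    then show ?thesis using IVT'[of u t 0 y] ut y cont by (auto simp: min_def max_def)
  next
    case False
    then show ?thesis using IVT2'[of u t 0 y] ut y cont by (auto simp: min_def max_def)
  qed
  then show False using nz sub by (metis atLeastAtMost_iff subsetD)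
qed

text \<open>
  On a nodal interval where \<open>u > 0\<close> and \<open>m \<le> 0\<close> the flux \<open>v = p u'\<close> would be nondecreasing, which
  is impossible between a simple zero (or \<open>T1\<close>) and the next zero (or \<open>T2\<close>).
\<close>

lemma nodal_intervals_alternation:
  assumes m: "continuous_on {T1..T2} m" and uv: "solves m a b u v" and ab: "0 \<le> a" "b \<le> 0"
    and nt: "nonzero_on u {T1..T2}" and v1: "v T1 = 0"
    and x: "T1 < x" "x \<le> T2" "v x \<le> 0" "k = 0 \<Longrightarrow> v x < 0"
    and left: "\<And>d. d < x \<Longrightarrow> \<exists>y\<in>{d<..<x}. u y > 0"
    and zeros: "has_exactly_k_zeros k u {T1<..<x}"
  shows "\<exists>t<x. alternation T1 k m t"
  using assms
proof (induction k arbitrary: m a b u v x)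
  \<comment> \<open>With no zero left, the interval starts at \<open>T1\<close>, where the flux is
    0, so the contradiction needs \<open>v x < 0\<close> strictly. With flux 0 at both ends there
    would be none: for \<open>q = 0\<close> and \<open>a = b = 0\<close> positive constants are
    solutions.\<close>
  case (0 m a b u v x)
  have contu: "continuous_on {T1..T2} u" using 0(2) by (simp add: solves_def)
  have "u t \<noteq> 0" if "t \<in> {T1<..<x}" for t
    using 0(12) that by (auto simp: has_exactly_k_zeros_def)
  moreover obtain y where "y \<in> {T1<..<x}" "u y > 0" using 0(11)[of T1] 0(7) by blast
  ultimately have pos: "u t > 0" if "t \<in> {T1<..<x}" for t
    using no_zero_imp_pos[OF contu, of T1 x y t] 0(8) that by simp
  have "\<exists>t\<in>{T1<..<x}. m t > 0"
  proof (rule ccontr)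
    assume "\<not> (\<exists>t\<in>{T1<..<x}. m t > 0)"
    then have "v T1 \<le> v x"
      using solves_flux_mono[OF 0(2,3), of T1 x] 0(7,8) pos by (simp add: not_less)
    then show False using 0(6,10) by simp
  qed
  then show ?case by auto
next
  case (Suc k m a b u v x)
  note prems = Suc.prems
  have contu: "continuous_on {T1..T2} u" using prems(2) by (simp add: solves_def)
  define Z where "Z = {t \<in> {T1<..<x}. u t = 0}"
  have Z: "finite Z" "card Z = Suc k" using prems(12) by (auto simp: has_exactly_k_zeros_def Z_def)
  define z where "z = Max Z"
  have "Z \<noteq> {}" using Z by auto
  then have zZ: "z \<in> Z" using Z(1) by (simp add: z_def)
  then have z: "T1 < z" "z < x" "u z = 0" by (auto simp: Z_def)
  have "u t \<noteq> 0" if "t \<in> {z<..<x}" for t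
    using Max_ge[OF Z(1), of t] that z by (auto simp: Z_def z_def)
  moreover obtain y where "y \<in> {z<..<x}" "u y > 0" using prems(11)[of z] z by blast
  ultimately have pos: "u t > 0" if "t \<in> {z<..<x}" for t
    using no_zero_imp_pos[OF contu, of z x y t] prems(8) z that by simp
  have deru: "(u has_real_derivative v z / p z) (at z)"
    using prems(2,8) z by (auto simp: solves_def)
  have pz: "p z > 0" using p_pos[of z] z prems(8) by simp
  have "v z \<noteq> 0"
    using solves_eq_0[OF prems(1,2), of z] z prems(5,8) by (auto simp: nonzero_on_def)
  \<comment> \<open>\<open>u\<close> is positive just to the right of \<open>z\<close>, so it cannot
    be decreasing there.\<close>
  moreover have "\<not> v z < 0"
  proof
    assume "v z < 0"
    then have "v z / p z < 0" using pz by (simp add: divide_neg_pos)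
    from DERIV_neg_dec_right[OF deru this] obtain d where
      d: "d > 0" "\<forall>h>0. h < d \<longrightarrow> u (z + h) < u z" by auto
    define h where "h = min (d/2) ((x - z)/2)"
    have "0 < h" "h < d" "z + h \<in> {z<..<x}" using d(1) z by (auto simp: h_def min_def field_simps)
    then show False using d(2) pos[of "z + h"] z by force
  qed
  ultimately have vz: "v z > 0" by simp
  have "\<exists>t\<in>{z<..<x}. m t > 0"
  proof (rule ccontr)
    assume "\<not> (\<exists>t\<in>{z<..<x}. m t > 0)"
    then have "v z \<le> v x"
      using solves_flux_mono[OF prems(2,3), of z x] z prems(8) pos by (simp add: not_less)
    then show False using vz prems(9) by simp
  qed
  then obtain t where t: "z < t" "t < x" "m t > 0" by auto
  \<comment> \<open>For \<open>- u\<close> the right end is now \<open>z\<close>, with flux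
    \<open>- v z < 0\<close>. This is the strict inequality that index 0 demands, and simplicity of
    the zero provides it.\<close>
  have "\<exists>s<z. alternation T1 k (\<lambda>x. - m x) s"
  proof (rule Suc.IH[OF _ solves_uminus[OF prems(2)]])
    show "continuous_on {T1..T2} (\<lambda>x. - m x)" using prems(1) by (rule continuous_on_minus)
    show "nonzero_on (\<lambda>x. - u x) {T1..T2}" using prems(5) by (simp add: nonzero_on_def)
    show "\<exists>y\<in>{d<..<z}. 0 < - u y" if "d < z" for d
    proof -
      have "v z / p z > 0" using vz pz by simp
      from DERIV_pos_inc_left[OF deru this] obtain e where
        e: "e > 0" "\<forall>h>0. h < e \<longrightarrow> u (z - h) < u z" by auto
      define h where "h = min (e/2) ((z - d)/2)"
      have "0 < h" "h < e" "z - h \<in> {d<..<z}" using e(1) that by (auto simp: h_def min_def field_simps)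
      then show ?thesis using e(2) z by (intro bexI[of _ "z - h"]) auto
    qed
    have "{t \<in> {T1<..<z}. - u t = 0} = Z - {z}"
      using Max_ge[OF Z(1)] z by (force simp: Z_def z_def[unfolded Z_def])
    then show "has_exactly_k_zeros k (\<lambda>x. - u x) {T1<..<z}"
      using Z zZ by (simp add: has_exactly_k_zeros_def)
  qed (use prems z vz in auto)
  then obtain s where "s < z" "alternation T1 k (\<lambda>x. - m x) s" by blast
  then show ?case using t by (intro exI[of _ t]) (auto intro!: exI[of _ s])
qed

lemma C_gt_imp_alternates:
  assumes m: "continuous_on {T1..T2} m" and k: "1 \<le> k"
    and "C_gt p q m T1 T2 k \<inter> ({0..} \<times> {..0}) \<noteq> {}"
  shows "alternates T1 T2 k m"
proof -
  obtain a b u where ab: "0 \<le> a" "b \<le> 0" and u: "neumann_solution p q m T1 T2 a b u"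
      "nonzero_on u {T1..T2}" "has_exactly_k_zeros k u {T1<..<T2}" "u T2 > 0"
    using assms(3) by (auto simp: C_gt_def)
  obtain v where v: "solves m a b u v" "v T1 = 0" "v T2 = 0"
    using u(1) by (rule neumann_solution_solves)
  have "\<exists>y\<in>{d<..<T2}. u y > 0" if "d < T2" for d
  proof -
    have "continuous_on {T1..T2} u" using v by (simp add: solves_def)
    then obtain e where e: "e > 0" "\<And>t. t \<in> {T1..T2} \<Longrightarrow> dist t T2 < e \<Longrightarrow> dist (u t) (u T2) < u T2"
      using u(4) T12 unfolding continuous_on_iff by (metis atLeastAtMost_iff less_eq_real_def)
    define y where "y = max (T2 - e/2) (max ((d + T2)/2) T1)"
    have "y \<in> {T1..T2}" "dist y T2 < e" using e(1) that T12 by (auto simp: y_def dist_real_def max_def field_simps)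
    then have "u y > 0" using e(2)[of y] by (auto simp: dist_real_def)
    moreover have "y \<in> {d<..<T2}" using e(1) that T12 by (auto simp: y_def max_def field_simps)
    ultimately show ?thesis by blast
  qed
  \<comment> \<open>At \<open>T2\<close> the flux is 0 and not negative, which is admissible because
    \<open>1 \<le> k\<close>.\<close>
  then show ?thesis
    unfolding alternates_def
    using nodal_intervals_alternation[OF m v(1) ab u(2) v(2), of T2 k] T12 v(3) u(3) k by auto
qed

end

section \<open>The Pruefer angle\<close>

context sturm_liouville
begin

text \<open>
  Pruefer angle: for \<open>u = r cos \<theta>\<close>, \<open>p u' = - r sin \<theta>\<close> the equation
  \<open>- (p u')' + q u = lam m \<bar>u\<bar>\<close>, which is the case \<open>(a, b) = (lam, - lam)\<close>, becomes \<open>\<theta>' = prufer m lam t \<theta>\<close>.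
\<close>

definition prufer :: "(real \<Rightarrow> real) \<Rightarrow> real \<Rightarrow> real \<Rightarrow> real \<Rightarrow> real" where
  "prufer m lam t x = (sin x)\<^sup>2 / p t - q t * (cos x)\<^sup>2 + lam * m t * cos x * \<bar>cos x\<bar>"

definition prufer_angle :: "(real \<Rightarrow> real) \<Rightarrow> real \<Rightarrow> (real \<Rightarrow> real) \<Rightarrow> bool" where
  "prufer_angle m lam th \<longleftrightarrow>
     (\<forall>t\<in>{T1..T2}. (th has_real_derivative prufer m lam t (th t)) (at t within {T1..T2}))"

text \<open>A half turn is the passage from \<open>u\<close> to \<open>- u\<close>. Only
  \<open>cos x * abs (cos x)\<close> is odd under it, so the weight changes sign, matching the
  recursive step of \<open>alternation\<close>.\<close>

lemma prufer_add_pi: "prufer (\<lambda>x. - m x) lam t (x + pi) = prufer m lam t x"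
  unfolding prufer_def sin_periodic_pi cos_periodic_pi by simp

lemma prufer_angle_add_pi:
  assumes "prufer_angle m lam th"
  shows "prufer_angle (\<lambda>x. - m x) lam (\<lambda>t. th t + pi)"
  unfolding prufer_angle_def prufer_add_pi
proof
  fix t assume "t \<in> {T1..T2}"
  then have "(th has_real_derivative prufer m lam t (th t)) (at t within {T1..T2})"
    using assms by (simp add: prufer_angle_def)
  from DERIV_add[OF this DERIV_const[of pi]]
  show "((\<lambda>t. th t + pi) has_real_derivative prufer m lam t (th t)) (at t within {T1..T2})" by simp
qed

lemma prufer_angle_cont: "prufer_angle m lam th \<Longrightarrow> continuous_on {T1..T2} th"
  unfolding prufer_angle_def by (rule DERIV_continuous_on) blast

lemma prufer_angle_deriv:
  "prufer_angle m lam th \<Longrightarrow> t \<in> {T1<..<T2} \<Longrightarrow> (th has_real_derivative prufer m lam t (th t)) (at t)"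
  unfolding prufer_angle_def using at_within_Icc_at[of T1 t T2]
  by (auto dest: bspec[where x = t])

text \<open>The constant is uniform for \<open>abs lam \<le> A\<close>, as continuous dependence on
  \<open>lam\<close> requires. On \<open>[-1, 1]\<close> both \<open>c^2\<close> and
  \<open>c * abs c\<close> are 2-Lipschitz, whence the factor 2.\<close>

lemma prufer_lipschitz:
  assumes m: "continuous_on {T1..T2} m"
  obtains L where "L > 0" "\<And>lam t x y. \<bar>lam\<bar> \<le> A \<Longrightarrow> t \<in> {T1..T2} \<Longrightarrow>
    \<bar>prufer m lam t x - prufer m lam t y\<bar> \<le> L * \<bar>x - y\<bar>"
proof -
  have sin: "\<bar>sin x - sin y\<bar> \<le> \<bar>x - y\<bar>" and cos: "\<bar>cos x - cos y\<bar> \<le> \<bar>x - y\<bar>" for x y :: real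
  proof -
    have *: "\<bar>f x - f y\<bar> \<le> \<bar>x - y\<bar>"
      if "\<And>z. (f has_real_derivative g z) (at z)" "\<And>z. \<bar>g z\<bar> \<le> 1" for f g :: "real \<Rightarrow> real"
      using field_differentiable_bound[of UNIV f g 1 x y] that by simp
    show "\<bar>sin x - sin y\<bar> \<le> \<bar>x - y\<bar>" by (rule *[of _ cos]) auto
    show "\<bar>cos x - cos y\<bar> \<le> \<bar>x - y\<bar>" by (rule *[of _ "\<lambda>z. - sin z"]) auto
  qed
  have sq: "\<bar>c\<^sup>2 - d\<^sup>2\<bar> \<le> 2 * \<bar>c - d\<bar>" and ab: "\<bar>c * \<bar>c\<bar> - d * \<bar>d\<bar>\<bar> \<le> 2 * \<bar>c - d\<bar>"
    if cd: "\<bar>c\<bar> \<le> 1" "\<bar>d\<bar> \<le> 1" for c d :: real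
  proof -
    have "\<bar>c\<^sup>2 - d\<^sup>2\<bar> = \<bar>c + d\<bar> * \<bar>c - d\<bar>"
      by (simp add: power2_eq_square square_diff_square_factored abs_mult)
    also have "\<dots> \<le> 2 * \<bar>c - d\<bar>" using cd by (intro mult_right_mono) auto
    finally show "\<bar>c\<^sup>2 - d\<^sup>2\<bar> \<le> 2 * \<bar>c - d\<bar>" .
    have "c * \<bar>c\<bar> - d * \<bar>d\<bar> = (c - d) * \<bar>c\<bar> + d * (\<bar>c\<bar> - \<bar>d\<bar>)" by (simp add: algebra_simps)
    also have "\<bar>\<dots>\<bar> \<le> \<bar>c - d\<bar> * \<bar>c\<bar> + \<bar>d\<bar> * \<bar>\<bar>c\<bar> - \<bar>d\<bar>\<bar>"
      using abs_triangle_ineq[of "(c - d) * \<bar>c\<bar>" "d * (\<bar>c\<bar> - \<bar>d\<bar>)"] by (simp add: abs_mult)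
    also have "\<dots> \<le> \<bar>c - d\<bar> * 1 + 1 * \<bar>c - d\<bar>"
      using cd by (intro add_mono mult_mono) auto
    finally show "\<bar>c * \<bar>c\<bar> - d * \<bar>d\<bar>\<bar> \<le> 2 * \<bar>c - d\<bar>" by simp
  qed
  have "continuous_on {T1..T2} (\<lambda>t. 2 * (1 / p t + q t + \<bar>A\<bar> * \<bar>m t\<bar>))"
    by (intro continuous_intros cont_inverse_p cont_q m)
  then obtain L where L: "L > 0" "\<And>t. t \<in> {T1..T2} \<Longrightarrow> \<bar>2 * (1 / p t + q t + \<bar>A\<bar> * \<bar>m t\<bar>)\<bar> \<le> L"
    using bounded_coefficient by blast
  have "\<bar>prufer m lam t x - prufer m lam t y\<bar> \<le> L * \<bar>x - y\<bar>"
    if lam: "\<bar>lam\<bar> \<le> A" and t: "t \<in> {T1..T2}" for lam t x y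
  proof -
    have nn: "1 / p t \<ge> 0" "q t \<ge> 0" using p_pos[OF t] q_nonneg[OF t] by auto
    have s: "\<bar>(sin x)\<^sup>2 - (sin y)\<^sup>2\<bar> \<le> 2 * \<bar>x - y\<bar>" using sq[of "sin x" "sin y"] sin[of x y] by simp
    have c: "\<bar>(cos x)\<^sup>2 - (cos y)\<^sup>2\<bar> \<le> 2 * \<bar>x - y\<bar>" using sq[of "cos x" "cos y"] cos[of x y] by simp
    have d: "\<bar>cos x * \<bar>cos x\<bar> - cos y * \<bar>cos y\<bar>\<bar> \<le> 2 * \<bar>x - y\<bar>" using ab[of "cos x" "cos y"] cos[of x y] by simp
    have "prufer m lam t x - prufer m lam t y = 1 / p t * ((sin x)\<^sup>2 - (sin y)\<^sup>2)
        - q t * ((cos x)\<^sup>2 - (cos y)\<^sup>2) + (lam * m t) * (cos x * \<bar>cos x\<bar> - cos y * \<bar>cos y\<bar>)"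
      by (simp add: prufer_def algebra_simps diff_divide_distrib)
    also have "\<bar>\<dots>\<bar> \<le> \<bar>1 / p t * ((sin x)\<^sup>2 - (sin y)\<^sup>2)\<bar>
        + \<bar>q t * ((cos x)\<^sup>2 - (cos y)\<^sup>2)\<bar> + \<bar>(lam * m t) * (cos x * \<bar>cos x\<bar> - cos y * \<bar>cos y\<bar>)\<bar>"
      by linarith
    also have "\<dots> \<le> 1 / p t * (2 * \<bar>x - y\<bar>) + q t * (2 * \<bar>x - y\<bar>) + \<bar>lam * m t\<bar> * (2 * \<bar>x - y\<bar>)"
      unfolding abs_mult[of "1 / p t"] abs_mult[of "q t"] abs_mult[of "lam * m t"]
        abs_of_nonneg[OF nn(1)] abs_of_nonneg[OF nn(2)]
      by (intro add_mono mult_left_mono s c d nn) auto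
    also have "\<dots> \<le> 1 / p t * (2 * \<bar>x - y\<bar>) + q t * (2 * \<bar>x - y\<bar>) + (\<bar>A\<bar> * \<bar>m t\<bar>) * (2 * \<bar>x - y\<bar>)"
      unfolding abs_mult[of lam] using lam by (intro add_left_mono mult_right_mono) auto
    also have "\<dots> = 2 * (1 / p t + q t + \<bar>A\<bar> * \<bar>m t\<bar>) * \<bar>x - y\<bar>" by (simp add: algebra_simps)
    also have "\<dots> \<le> L * \<bar>x - y\<bar>" using L(2)[OF t] by (intro mult_right_mono) auto
    finally show ?thesis .
  qed
  with L(1) show thesis by (rule that)
qed

lemma prufer_angle_exists:
  assumes m: "continuous_on {T1..T2} m"
  shows "\<exists>th. th T1 = x0 \<and> prufer_angle m lam th"
proof -
  obtain L where "L > 0" "\<And>t x y. t \<in> {T1..T2} \<Longrightarrow>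
      \<bar>prufer m lam t x - prufer m lam t y\<bar> \<le> L * \<bar>x - y\<bar>"
    using prufer_lipschitz[OF m, of "\<bar>lam\<bar>"] by (metis order_refl)
  moreover have "continuous_on ({T1..T2} \<times> UNIV) (\<lambda>(t, x). prufer m lam t x)"
  proof -
    have fst: "continuous_on ({T1..T2} \<times> (UNIV :: real set)) (\<lambda>z. f (fst z))"
      if "continuous_on {T1..T2} f" for f :: "real \<Rightarrow> real"
      by (rule continuous_on_compose2[OF that]) (auto intro!: continuous_intros)
    show ?thesis
      unfolding prufer_def split_beta
      by (intro continuous_intros fst cont_p cont_q m) (use p_pos in fastforce)
  qed
  ultimately show ?thesis
    using lipschitz_ode_solution_exists[OF T12, of "prufer m lam" L x0] unfolding prufer_angle_def by blast
qed

section \<open>Barriers for the angle and fast rotation\<close>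

text \<open>Where \<open>cos e = 0\<close> the field is \<open>(sin e)^2 / p \<ge> 0\<close>,
  whatever \<open>m\<close> and \<open>lam\<close> are, so the constant \<open>e\<close> is a lower
  barrier.\<close>

lemma prufer_angle_ge_mono:
  assumes m: "continuous_on {T1..T2} m" and th: "prufer_angle m lam th"
    and e: "cos e = 0" and cd: "T1 \<le> c" "c \<le> d" "d \<le> T2" and "e \<le> th c"
  shows "e \<le> th d"
proof -
  obtain L where L: "L > 0" "\<And>t x y. t \<in> {T1..T2} \<Longrightarrow>
      \<bar>prufer m lam t x - prufer m lam t y\<bar> \<le> L * \<bar>x - y\<bar>"
    using prufer_lipschitz[OF m, of "\<bar>lam\<bar>"] by (metis order_refl)
  have "e - th d \<le> 0"
  proof (rule subsolution_nonpos[of c d "\<lambda>t. e - th t" L])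
    show "continuous_on {c..d} (\<lambda>t. e - th t)"
      by (intro continuous_intros continuous_on_subset[OF prufer_angle_cont[OF th]]) (use cd in auto)
    fix t assume t: "c < t" "t < d" "0 < e - th t"
    have "prufer m lam t e \<ge> 0" using p_pos[of t] t cd by (simp add: prufer_def e)
    then have "- prufer m lam t (th t) \<le> L * (e - th t)" using L(2)[of t "th t" e] t cd by auto
    moreover have "((\<lambda>t. e - th t) has_real_derivative - prufer m lam t (th t)) (at t)"
      using DERIV_diff[OF DERIV_const prufer_angle_deriv[OF th, of t]] t cd by simp
    ultimately show "\<exists>d. ((\<lambda>t. e - th t) has_real_derivative d) (at t) \<and> d \<le> L * (e - th t)" by blast
  qed (use assms in auto)
  then show ?thesis by simp
qed

text \<open>The angle crosses the levels \<open>\<pi>/2 + k \<pi>\<close> upwards only, with speed \<open>1/p\<close>.\<close>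

lemma prufer_angle_gt_mono:
  assumes m: "continuous_on {T1..T2} m" and th: "prufer_angle m lam th"
    and e: "cos e = 0" and cd: "T1 \<le> c" "c < d" "d < T2" and "e \<le> th c"
  shows "e < th d"
proof (rule ccontr)
  assume "\<not> e < th d"
  then have thd: "th d = e" using prufer_angle_ge_mono[OF m th e, of c d] assms by simp
  have "(sin e)\<^sup>2 = 1" using sin_cos_squared_add[of e] e by simp
  then have "prufer m lam d (th d) > 0"
    using p_pos[of d] cd by (simp add: prufer_def e thd)
  from DERIV_pos_inc_left[OF prufer_angle_deriv[OF th, of d] this] cd
  obtain h0 where h0: "h0 > 0" "\<forall>h>0. h < h0 \<longrightarrow> th (d - h) < th d" by auto
  define h where "h = min (h0/2) (d - c)"
  have h: "0 < h" "h < h0" "c \<le> d - h" using h0 cd by (auto simp: h_def)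
  then have "e \<le> th (d - h)" using prufer_angle_ge_mono[OF m th e, of c "d - h"] assms by simp
  then show False using h0(2) h thd by auto
qed

text \<open>On \<open>m \<ge> \<delta>\<close> the speed in the strip between \<open>- pi/2\<close>
  and \<open>pi/2\<close> is at least \<open>\<alpha> * sin^2 + B * cos^2\<close>. At that speed
  crossing the strip takes the time \<open>pi / sqrt (\<alpha> * B)\<close>, which is small once
  \<open>lam\<close> makes \<open>B\<close> large.\<close>

lemma prufer_angle_rotates:
  assumes m: "continuous_on {T1..T2} m" and cd: "T1 \<le> c" "c < d" "d \<le> T2"
    and del: "\<delta> > 0" "\<And>t. t \<in> {c..d} \<Longrightarrow> \<delta> \<le> m t"
  shows "\<exists>\<Lambda>. \<forall>lam\<ge>\<Lambda>. \<forall>th. prufer_angle m lam th \<longrightarrow> - (pi/2) \<le> th c \<longrightarrow> pi/2 \<le> th d"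
proof -
  obtain P where P: "P > 0" "\<And>t. t \<in> {T1..T2} \<Longrightarrow> \<bar>p t\<bar> \<le> P" using bounded_coefficient[OF cont_p] by blast
  obtain Q where Q: "Q > 0" "\<And>t. t \<in> {T1..T2} \<Longrightarrow> \<bar>q t\<bar> \<le> Q" using bounded_coefficient[OF cont_q] by blast
  \<comment> \<open>\<open>\<Lambda>\<close> is chosen so that
    \<open>\<Lambda> * \<delta> - Q = B\<close>, and \<open>w\<close> so that
    \<open>w^2 * B = \<alpha>\<close> and \<open>w * B = 3 * pi / (d - c)\<close>: a third of the
    interval then contributes \<open>pi\<close>.\<close>
  define \<alpha> w B \<Lambda> where "\<alpha> = 1 / P" and "w = \<alpha> * (d - c) / (3 * pi)" and "B = \<alpha> / w\<^sup>2" and "\<Lambda> = (B + Q) / \<delta>"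
  have pos: "\<alpha> > 0" "w > 0" "B > 0" using P cd by (auto simp: \<alpha>_def w_def B_def)
  have wB: "w\<^sup>2 * B = \<alpha>" using pos by (simp add: B_def)
  have "pi/2 \<le> th d" if lam: "lam \<ge> \<Lambda>" and th: "prufer_angle m lam th" and start: "- (pi/2) \<le> th c" for lam th
  proof (rule ccontr)
    assume "\<not> pi/2 \<le> th d"
    then have up: "th t < pi/2" if "t \<in> {c..d}" for t
      using prufer_angle_ge_mono[OF m th cos_pi_half, of t d] that cd by fastforce
    have low: "th t > - (pi/2)" if "t \<in> {c<..<d}" for t
      using prufer_angle_gt_mono[OF m th, of "- (pi/2)" c t] that start cd by simp
    have cpos: "cos (th t) > 0" if "t \<in> {c<..<d}" for t
      using up[of t] low[of t] that by (intro cos_gt_zero_pi) auto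
    have speed: "\<alpha> * (sin (th t))\<^sup>2 + B * (cos (th t))\<^sup>2 \<le> prufer m lam t (th t)" if t: "t \<in> {c<..<d}" for t
    proof -
      have "\<Lambda> * \<delta> \<le> lam * m t"
        using lam del(1) del(2)[of t] t Q pos by (intro mult_mono) (auto simp: \<Lambda>_def intro!: order_trans[OF _ lam])
      then have "B \<le> lam * m t - q t" using Q(2)[of t] t cd del(1) by (auto simp: \<Lambda>_def)
      then have "B * (cos (th t))\<^sup>2 \<le> (lam * m t - q t) * (cos (th t))\<^sup>2" by (intro mult_right_mono) auto
      moreover have "\<alpha> \<le> 1 / p t" unfolding \<alpha>_def using P(2)[of t] p_pos[of t] t cd by (intro divide_left_mono) auto
      then have "\<alpha> * (sin (th t))\<^sup>2 \<le> 1 / p t * (sin (th t))\<^sup>2" by (intro mult_right_mono) auto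
      moreover have "prufer m lam t (th t) = 1 / p t * (sin (th t))\<^sup>2 + (lam * m t - q t) * (cos (th t))\<^sup>2"
        using cpos[OF t] by (simp add: prufer_def power2_eq_square algebra_simps)
      ultimately show ?thesis by linarith
    qed
    \<comment> \<open>The rescaled angle straightens the lower bound: its derivative is
      \<open>w * \<theta>' / (cos^2 + w^2 * sin^2)\<close>, and
      \<open>\<alpha> * sin^2 + B * cos^2\<close> is \<open>B\<close> times this
      denominator.\<close>
    define g where "g t = arctan (w * tan (th t))" for t
    have derg: "\<exists>y. (g has_real_derivative y) (at t) \<and> w * B \<le> y" if t: "t \<in> {c<..<d}" for t
    proof -
      define C where "C = cos (th t)"
      define S where "S = tan (th t)"
      define F where "F = prufer m lam t (th t)"
      have C: "C > 0" using cpos[OF t] by (simp add: C_def)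
      have SC: "sin (th t) = S * C" using C by (simp add: S_def C_def tan_def)
      have dth: "(th has_real_derivative F) (at t)"
        unfolding F_def using t cd by (intro prufer_angle_deriv[OF th]) auto
      have "((\<lambda>t. w * tan (th t)) has_real_derivative w * (inverse (C\<^sup>2) * F)) (at t)"
        using DERIV_cmult[OF DERIV_chain2[OF DERIV_tan dth], of w] C by (simp add: C_def)
      then have "(g has_real_derivative inverse (1 + (w * S)\<^sup>2) * (w * (inverse (C\<^sup>2) * F))) (at t)"
        unfolding g_def S_def by (rule DERIV_chain2[OF DERIV_arctan])
      moreover have "w * B \<le> inverse (1 + (w * S)\<^sup>2) * (w * (inverse (C\<^sup>2) * F))"
      proof -
        have pos1: "1 + (w * S)\<^sup>2 > 0" by (intro add_pos_nonneg) auto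
        have "B * (1 + (w * S)\<^sup>2) * C\<^sup>2 = (w\<^sup>2 * B) * (S * C)\<^sup>2 + B * C\<^sup>2"
          by (simp add: power_mult_distrib algebra_simps)
        also have "\<dots> \<le> F" using speed[OF t] by (simp add: wB SC F_def C_def)
        finally have "B \<le> F / ((1 + (w * S)\<^sup>2) * C\<^sup>2)"
          using pos1 C by (simp add: pos_le_divide_eq mult.assoc)
        then have "w * B \<le> w * (F / ((1 + (w * S)\<^sup>2) * C\<^sup>2))" using pos by (intro mult_left_mono) auto
        also have "\<dots> = inverse (1 + (w * S)\<^sup>2) * (w * (inverse (C\<^sup>2) * F))"
          by (simp add: divide_inverse mult_ac)
        finally show ?thesis .
      qed
      ultimately show ?thesis by blast
    qed
    \<comment> \<open>At \<open>c\<close> the angle may equal \<open>- pi/2\<close>, where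
      \<open>tan\<close> has a pole; the middle third stays away from it. A gain of
      \<open>pi\<close> there is impossible, as two values of \<open>arctan\<close> differ by less
      than \<open>pi\<close>.\<close>
    define c' d' where "c' = c + (d - c) / 3" and "d' = d - (d - c) / 3"
    have c'd': "c < c'" "c' < d'" "d' < d" "d' - c' = (d - c) / 3" using cd by (auto simp: c'_def d'_def field_simps)
    have "g c' - w * B * c' \<le> g d' - w * B * d'"
    proof (rule DERIV_nonneg_imp_nondecreasing[of c' d' "\<lambda>t. g t - w * B * t"])
      fix t assume "c' \<le> t" "t \<le> d'"
      then obtain y where "(g has_real_derivative y) (at t)" "w * B \<le> y" using derg[of t] c'd' by auto
      moreover from this(1) have "((\<lambda>t. g t - w * B * t) has_real_derivative y - w * B) (at t)"
        by (auto intro!: derivative_eq_intros)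
      ultimately show "\<exists>y. ((\<lambda>t. g t - w * B * t) has_real_derivative y) (at t) \<and> 0 \<le> y" by force
    qed (use c'd' in auto)
    moreover have "w * B * (d' - c') = pi"
    proof -
      have "w * B = \<alpha> / w" using pos by (simp add: B_def power2_eq_square)
      also have "\<dots> = 3 * pi / (d - c)" using pos(1) cd by (simp add: w_def)
      finally show ?thesis unfolding c'd'(4) using cd by simp
    qed
    ultimately have "pi \<le> g d' - g c'" by (simp add: algebra_simps)
    then show False using arctan_bounded[of "w * tan (th d')"] arctan_bounded[of "w * tan (th c')"]
      by (simp add: g_def)
  qed
  then show ?thesis by blast
qed

lemma pos_interval:
  fixes m :: "real \<Rightarrow> real"
  assumes m: "continuous_on {T1..T2} m" and "m t > 0" and t: "T1 \<le> lo" "lo < t" "t < hi" "hi \<le> T2"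
  obtains c d \<delta> where "lo < c" "c < d" "d < hi" "\<delta> > 0" "\<And>x. x \<in> {c..d} \<Longrightarrow> \<delta> \<le> m x"
proof -
  have "t \<in> {T1..T2}" "m t / 2 > 0" using assms by auto
  then obtain e where e: "e > 0" "\<And>x. x \<in> {T1..T2} \<Longrightarrow> dist x t < e \<Longrightarrow> dist (m x) (m t) < m t / 2"
    using m unfolding continuous_on_iff by blast
  define r where "r = Min {e/2, (t - lo)/2, (hi - t)/2}"
  have r: "r > 0" "r < e" "r < t - lo" "r < hi - t"
    using e(1) t by (auto simp: r_def min_def)
  have "m t / 2 \<le> m x" if "x \<in> {t - r..t + r}" for x
  proof -
    have "x \<in> {T1..T2}" "dist x t < e" using that r t by (auto simp: dist_real_def)
    then show ?thesis using e(2)[of x] unfolding dist_real_def by linarith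
  qed
  then show thesis using that[of "t - r" "t + r" "m t / 2"] r \<open>m t > 0\<close> by simp
qed

text \<open>Each of the \<open>k + 1\<close> points yields a half turn on a small interval around
  it. In between, the angle cannot fall below the level \<open>- pi/2 + j pi\<close> already gained,
  since the cosine vanishes there.\<close>

lemma prufer_angle_rotates_alternation:
  assumes "continuous_on {T1..T2} m" "alternation T1 k m t" "t < y" "y \<le> T2"
  shows "\<exists>\<Lambda>. \<forall>lam\<ge>\<Lambda>. \<forall>th. prufer_angle m lam th \<longrightarrow> - (real k * pi) - pi/2 \<le> th T1 \<longrightarrow> pi/2 \<le> th y"
  using assms
proof (induction k arbitrary: m t y)
  case (0 m t y)
  then have t: "T1 < t" "m t > 0" by auto
  obtain c d \<delta> where cd: "T1 < c" "c < d" "d < y" "\<delta> > 0" "\<And>x. x \<in> {c..d} \<Longrightarrow> \<delta> \<le> m x"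
    using pos_interval[OF 0(1) t(2) order_refl t(1) 0(3,4)] by blast
  have "T1 \<le> c" "d \<le> T2" using cd 0(4) by auto
  from prufer_angle_rotates[OF 0(1) this(1) cd(2) this(2) cd(4,5)]
  obtain \<Lambda> where \<Lambda>: "\<And>lam th. \<Lambda> \<le> lam \<Longrightarrow> prufer_angle m lam th \<Longrightarrow> - (pi/2) \<le> th c \<Longrightarrow> pi/2 \<le> th d"
    by blast
  have "pi/2 \<le> th y" if "\<Lambda> \<le> lam" and th: "prufer_angle m lam th" and s: "- (pi/2) \<le> th T1" for lam th
  proof -
    have "- (pi/2) \<le> th c" using prufer_angle_ge_mono[OF 0(1) th _ _ _ _ s, of c] cd 0(4) by simp
    then have "pi/2 \<le> th d" using \<Lambda> that by blast
    then show ?thesis using prufer_angle_ge_mono[OF 0(1) th cos_pi_half, of d y] cd 0(4) by simp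
  qed
  then show ?case by (intro exI[of _ \<Lambda>]) auto
next
  case (Suc k m t y)
  then obtain s where s: "s < t" "alternation T1 k (\<lambda>x. - m x) s" and t: "m t > 0" by auto
  have s1: "T1 < s" using alternation_gt[OF s(2)] .
  obtain c d \<delta> where cd: "s < c" "c < d" "d < y" "\<delta> > 0" "\<And>x. x \<in> {c..d} \<Longrightarrow> \<delta> \<le> m x"
    using pos_interval[OF Suc.prems(1) t less_imp_le[OF s1] s(1) Suc.prems(3,4)] by blast
  have cd': "T1 \<le> c" "d \<le> T2" "c \<le> T2" using cd s1 Suc.prems(4) by auto
  from prufer_angle_rotates[OF Suc.prems(1) cd'(1) cd(2) cd'(2) cd(4,5)]
  obtain \<Lambda> where \<Lambda>: "\<And>lam th. \<Lambda> \<le> lam \<Longrightarrow> prufer_angle m lam th \<Longrightarrow> - (pi/2) \<le> th c \<Longrightarrow> pi/2 \<le> th d"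
    by blast
  from Suc.IH[OF continuous_on_minus[OF Suc.prems(1)] s(2) cd(1) cd'(3)]
  obtain \<Lambda>' where \<Lambda>': "\<And>lam th. \<Lambda>' \<le> lam \<Longrightarrow> prufer_angle (\<lambda>x. - m x) lam th \<Longrightarrow>
      - (real k * pi) - pi/2 \<le> th T1 \<Longrightarrow> pi/2 \<le> th c"
    by blast
  have "pi/2 \<le> th y" if lam: "max \<Lambda> \<Lambda>' \<le> lam" and th: "prufer_angle m lam th"
    and start: "- (real (Suc k) * pi) - pi/2 \<le> th T1" for lam th
  proof -
    \<comment> \<open>For \<open>- m\<close> the shifted angle has made its \<open>k + 1\<close>
      half turns before \<open>c\<close>; for \<open>th\<close> itself this is the level
      \<open>- pi/2\<close>, from which the last half turn starts.\<close>
    have "pi/2 \<le> th c + pi"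
      using \<Lambda>'[OF _ prufer_angle_add_pi[OF th]] lam start by (simp add: algebra_simps)
    then have "pi/2 \<le> th d" using \<Lambda>[of lam th] lam th by simp
    then show ?thesis using prufer_angle_ge_mono[OF Suc.prems(1) th cos_pi_half, of d y] cd cd' Suc.prems(4) by simp
  qed
  then show ?case by (intro exI[of _ "max \<Lambda> \<Lambda>'"]) blast
qed

section \<open>Shooting in the parameter\<close>

lemma prufer_angle_param_lipschitz:
  assumes m: "continuous_on {T1..T2} m"
  obtains C where "C \<ge> 0" "\<And>lam mu th ph. \<bar>lam\<bar> \<le> A \<Longrightarrow> \<bar>mu\<bar> \<le> A \<Longrightarrow> prufer_angle m lam th \<Longrightarrow>
    prufer_angle m mu ph \<Longrightarrow> th T1 = ph T1 \<Longrightarrow> th T2 - ph T2 \<le> C * \<bar>lam - mu\<bar>"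
proof -
  obtain L where L: "L > 0" "\<And>lam t x y. \<bar>lam\<bar> \<le> A \<Longrightarrow> t \<in> {T1..T2} \<Longrightarrow>
    \<bar>prufer m lam t x - prufer m lam t y\<bar> \<le> L * \<bar>x - y\<bar>"
    using prufer_lipschitz[OF m, of A] by blast
  obtain M where M: "M > 0" "\<And>t. t \<in> {T1..T2} \<Longrightarrow> \<bar>m t\<bar> \<le> M" using bounded_coefficient[OF m] by blast
  have "th T2 - ph T2 \<le> M / L * (exp (L * (T2 - T1)) - 1) * \<bar>lam - mu\<bar>"
    if A: "\<bar>lam\<bar> \<le> A" and th: "prufer_angle m lam th" and ph: "prufer_angle m mu ph"
      and eq: "th T1 = ph T1" for lam mu th ph
  proof -
    \<comment> \<open>The solution of \<open>g' = L * g + M * abs (lam - mu)\<close> with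
      \<open>g T1 = 0\<close>, where \<open>M * abs (lam - mu)\<close> bounds the change of the
      field caused by the parameter.\<close>
    define g where "g t = M / L * (exp (L * (t - T1)) - 1) * \<bar>lam - mu\<bar>" for t
    have "th T2 - ph T2 - g T2 \<le> 0"
    proof (rule subsolution_nonpos[of T1 T2 "\<lambda>t. th t - ph t - g t" L])
      show "continuous_on {T1..T2} (\<lambda>t. th t - ph t - g t)"
        unfolding g_def by (intro continuous_intros prufer_angle_cont[OF th] prufer_angle_cont[OF ph])
      show "th T1 - ph T1 - g T1 \<le> 0" using eq by (simp add: g_def)
      fix t assume t: "T1 < t" "t < T2" "0 < th t - ph t - g t"
      have "L * (t - T1) \<ge> 0" using t L by simp
      then have "exp (L * (t - T1)) \<ge> 1" by simp
      then have g0: "g t \<ge> 0" unfolding g_def using M L by (intro mult_nonneg_nonneg) auto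
      have dg: "(g has_real_derivative L * g t + M * \<bar>lam - mu\<bar>) (at t)"
        unfolding g_def using L by (auto intro!: derivative_eq_intros simp: field_simps)
      have "\<bar>prufer m lam t (th t) - prufer m lam t (ph t)\<bar> \<le> L * (th t - ph t)"
        using L(2)[OF A, of t "th t" "ph t"] t g0 by simp
      moreover have "prufer m lam t (ph t) - prufer m mu t (ph t) \<le> M * \<bar>lam - mu\<bar>"
      proof -
        have "prufer m lam t (ph t) - prufer m mu t (ph t) = (lam - mu) * m t * (cos (ph t) * \<bar>cos (ph t)\<bar>)"
          by (simp add: prufer_def algebra_simps)
        also have "\<dots> \<le> \<bar>lam - mu\<bar> * \<bar>m t\<bar> * (\<bar>cos (ph t)\<bar> * \<bar>cos (ph t)\<bar>)"
          using abs_ge_self[of "(lam - mu) * m t * (cos (ph t) * \<bar>cos (ph t)\<bar>)"] by (simp add: abs_mult)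
        also have "\<dots> \<le> \<bar>lam - mu\<bar> * M * (1 * 1)"
          using M(2)[of t] M(1) t by (intro mult_mono) auto
        finally show ?thesis by (simp add: mult.commute)
      qed
      ultimately have le: "prufer m lam t (th t) - prufer m mu t (ph t) - (L * g t + M * \<bar>lam - mu\<bar>)
          \<le> L * (th t - ph t - g t)"
        by (simp add: algebra_simps)
      have "((\<lambda>t. th t - ph t - g t) has_real_derivative
          prufer m lam t (th t) - prufer m mu t (ph t) - (L * g t + M * \<bar>lam - mu\<bar>)) (at t)"
        using t by (intro DERIV_diff dg prufer_angle_deriv[OF th] prufer_angle_deriv[OF ph]) auto
      with le show "\<exists>d. ((\<lambda>t. th t - ph t - g t) has_real_derivative d) (at t) \<and> d \<le> L * (th t - ph t - g t)"
        by blast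
    qed (use T12 in auto)
    then show ?thesis by (simp add: g_def)
  qed
  moreover have "M / L * (exp (L * (T2 - T1)) - 1) \<ge> 0"
    using M L T12 by (intro mult_nonneg_nonneg) auto
  ultimately show thesis using that by blast
qed

text \<open>At multiples of \<open>pi\<close> the field for \<open>lam = 0\<close> is
  \<open>- q \<le> 0\<close>, so the initial value is an upper barrier.\<close>

lemma prufer_angle_zero_param:
  assumes m: "continuous_on {T1..T2} m" and th: "prufer_angle m 0 th" and "th T1 = - (real k * pi)"
  shows "th T2 \<le> - (real k * pi)"
proof -
  obtain L where L: "L > 0" "\<And>t x y. t \<in> {T1..T2} \<Longrightarrow>
      \<bar>prufer m 0 t x - prufer m 0 t y\<bar> \<le> L * \<bar>x - y\<bar>"
    using prufer_lipschitz[OF m, of 0] by (metis abs_zero order_refl)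
  have "th T2 - - (real k * pi) \<le> 0"
  proof (rule subsolution_nonpos[of T1 T2 "\<lambda>t. th t - - (real k * pi)" L])
    show "continuous_on {T1..T2} (\<lambda>t. th t - - (real k * pi))"
      by (intro continuous_intros prufer_angle_cont[OF th])
    fix t assume t: "T1 < t" "t < T2" "0 < th t - - (real k * pi)"
    have "prufer m 0 t (- (real k * pi)) \<le> 0" using q_nonneg[of t] t by (simp add: prufer_def)
    then have "prufer m 0 t (th t) \<le> L * (th t - - (real k * pi))"
      using L(2)[of t "th t" "- (real k * pi)"] t by auto
    moreover have "((\<lambda>t. th t - - (real k * pi)) has_real_derivative prufer m 0 t (th t)) (at t)"
      using DERIV_diff[OF prufer_angle_deriv[OF th, of t] DERIV_const[of "- (real k * pi)"]] t by simp
    ultimately show "\<exists>d. ((\<lambda>t. th t - - (real k * pi)) has_real_derivative d) (at t)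
        \<and> d \<le> L * (th t - - (real k * pi))" by blast
  qed (use assms T12 in auto)
  then show ?thesis by simp
qed

text \<open>Both end values are multiples of \<open>pi\<close>, which encodes the Neumann
  conditions; their difference will fix the number of zeros, and the final value 0 makes
  \<open>cos\<close>, hence \<open>u(T2)\<close>, positive.\<close>

lemma prufer_angle_shooting:
  assumes m: "continuous_on {T1..T2} m" and "alternates T1 T2 k m"
  shows "\<exists>lam\<ge>0. \<exists>th. prufer_angle m lam th \<and> th T1 = - (real k * pi) \<and> th T2 = 0"
proof -
  obtain t where "t < T2" "alternation T1 k m t" using assms(2) by (auto simp: alternates_def)
  from prufer_angle_rotates_alternation[OF m this(2,1) order_refl] obtain \<Lambda>0 where
    \<Lambda>0: "\<And>lam th. \<Lambda>0 \<le> lam \<Longrightarrow> prufer_angle m lam th \<Longrightarrow> - (real k * pi) - pi/2 \<le> th T1 \<Longrightarrow> pi/2 \<le> th T2"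
    by blast
  define \<Lambda> where "\<Lambda> = max 0 \<Lambda>0"
  \<comment> \<open>One angle is chosen for each \<open>lam\<close>; continuity in
    \<open>lam\<close> follows because the Lipschitz estimate compares arbitrary solutions with the
    same initial value.\<close>
  have "\<forall>lam. \<exists>th. th T1 = - (real k * pi) \<and> prufer_angle m lam th"
    using prufer_angle_exists[OF m] by blast
  then obtain th where th: "\<And>lam. th lam T1 = - (real k * pi)" "\<And>lam. prufer_angle m lam (th lam)"
    by metis
  obtain C where C: "C \<ge> 0" "\<And>lam mu th ph. \<bar>lam\<bar> \<le> \<Lambda> \<Longrightarrow> \<bar>mu\<bar> \<le> \<Lambda> \<Longrightarrow> prufer_angle m lam th \<Longrightarrow>
    prufer_angle m mu ph \<Longrightarrow> th T1 = ph T1 \<Longrightarrow> th T2 - ph T2 \<le> C * \<bar>lam - mu\<bar>"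
    using prufer_angle_param_lipschitz[OF m, of \<Lambda>] by blast
  have "C-lipschitz_on {0..\<Lambda>} (\<lambda>lam. th lam T2)"
  proof (rule lipschitz_onI)
    fix x y assume "x \<in> {0..\<Lambda>}" "y \<in> {0..\<Lambda>}"
    then show "dist (th x T2) (th y T2) \<le> C * dist x y"
      using C(2)[of x y "th x" "th y"] C(2)[of y x "th y" "th x"] th
      by (auto simp: dist_real_def abs_le_iff abs_minus_commute)
  qed (rule C)
  then have "continuous_on {0..\<Lambda>} (\<lambda>lam. th lam T2)" by (rule lipschitz_on_continuous_on)
  moreover have "th 0 T2 \<le> - (real k * pi)"
    using prufer_angle_zero_param[OF m th(2) th(1)] .
  then have "th 0 T2 \<le> 0" by (rule order_trans) simp
  moreover have "0 \<le> th \<Lambda> T2"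
    using \<Lambda>0[of \<Lambda> "th \<Lambda>"] th by (auto simp: \<Lambda>_def intro: order_trans[of 0 "pi/2"])
  ultimately obtain lam where "0 \<le> lam" "th lam T2 = 0"
    using IVT'[of "\<lambda>lam. th lam T2" 0 0 \<Lambda>] by (auto simp: \<Lambda>_def)
  then show ?thesis using th by blast
qed

section \<open>From the angle back to a solution\<close>

lemma prufer_angle_zeros:
  assumes m: "continuous_on {T1..T2} m" and th: "prufer_angle m lam th"
    and th1: "th T1 = - (real k * pi)" and th2: "th T2 = 0"
  shows "has_exactly_k_zeros k (\<lambda>t. cos (th t)) {T1<..<T2}"
proof -
  \<comment> \<open>The levels \<open>e 1 > ... > e k\<close> are exactly the zeros of
    \<open>cos\<close> between \<open>- k pi\<close> and 0. Each is attained by the intermediate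
    value theorem, and only once because crossings go upwards.\<close>
  define e where "e j = pi/2 - real j * pi" for j
  have cose: "cos (e j) = 0" for j by (simp add: e_def cos_diff)
  have "\<exists>t\<in>{T1<..<T2}. th t = e j" if j: "j \<in> {1..k}" for j
  proof -
    have "real 1 * pi \<le> real j * pi" "real j * pi \<le> real k * pi"
      using j by (intro mult_right_mono; simp)+
    then have lt: "th T1 < e j" "e j < th T2" 
      unfolding th1 th2 e_def using pi_gt_zero by linarith+
    then obtain t where "T1 \<le> t" "t \<le> T2" "th t = e j"
      using IVT'[of th T1 "e j" T2] T12 prufer_angle_cont[OF th] by auto
    then show ?thesis using lt by (intro bexI[of _ t]) (auto simp: less_le)
  qed
  then obtain \<tau> where \<tau>: "\<And>j. j \<in> {1..k} \<Longrightarrow> \<tau> j \<in> {T1<..<T2} \<and> th (\<tau> j) = e j" by metis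
  have once: "s = t" if "s \<in> {T1<..<T2}" "t \<in> {T1<..<T2}" "th s = e j" "th t = e j" for s t j
    using prufer_angle_gt_mono[OF m th cose, of s t j] prufer_angle_gt_mono[OF m th cose, of t s j] that
    by (cases s t rule: linorder_cases) auto
  have "{t \<in> {T1<..<T2}. cos (th t) = 0} = \<tau> ` {1..k}"
  proof (intro equalityI subsetI)
    fix t assume "t \<in> {t \<in> {T1<..<T2}. cos (th t) = 0}"
    then have t: "T1 < t" "t < T2" "cos (th t) = 0" by auto
    then obtain i where "odd i" "th t = of_int i * (pi/2)" by (auto simp: cos_zero_iff_int)
    then obtain l where "th t = of_int (2 * l + 1) * (pi/2)" by (auto elim: oddE)
    then have l: "th t = pi/2 + of_int l * pi" by (simp add: algebra_simps)
    \<comment> \<open>A level of at least \<open>pi/2\<close>, once reached, would keep the angle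
      away from its final value 0.\<close>
    have "l < 0"
    proof (rule ccontr)
      assume "\<not> l < 0"
      then have "pi/2 \<le> th t" by (simp add: l)
      then show False using prufer_angle_ge_mono[OF m th cos_pi_half, of t T2] t th2 pi_gt_zero by simp
    qed
    \<comment> \<open>\<open>e (Suc k)\<close> lies below the initial value, so the angle stays
      above it.\<close>
    moreover have "- l \<le> int k"
    proof (rule ccontr)
      assume "\<not> - l \<le> int k"
      then have "of_int l \<le> - real (Suc k)" by linarith
      then have "of_int l * pi \<le> - real (Suc k) * pi" by (rule mult_right_mono) simp
      then have "th t \<le> e (Suc k)" unfolding l e_def by (simp only: mult_minus_left)
      moreover have "e (Suc k) \<le> th T1" using pi_gt_zero by (simp add: e_def th1 algebra_simps)
      then have "e (Suc k) < th t" using prufer_angle_gt_mono[OF m th cose _ t(1,2)] by simp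
      ultimately show False by simp
    qed
    ultimately have j: "nat (- l) \<in> {1..k}" by auto
    have "th t = e (nat (- l))" using \<open>l < 0\<close> by (simp add: l e_def)
    then have "t = \<tau> (nat (- l))" using once[of t "\<tau> (nat (- l))"] \<tau>[OF j] t by auto
    then show "t \<in> \<tau> ` {1..k}" using j by blast
  qed (use \<tau> cose in auto)
  moreover have "inj_on \<tau> {1..k}"
  proof (rule inj_onI)
    fix i j assume "i \<in> {1..k}" "j \<in> {1..k}" "\<tau> i = \<tau> j"
    then have "e i = e j" using \<tau>[of i] \<tau>[of j] by simp
    then show "i = j" by (simp add: e_def)
  qed
  ultimately show ?thesis by (simp add: has_exactly_k_zeros_def card_image)
qed

text \<open>By homogeneity the angle equation is closed, and the amplitude follows by one
  integration of \<open>(ln r)' = R\<close>.\<close>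

lemma prufer_angle_neumann_solution:
  assumes m: "continuous_on {T1..T2} m" and th: "prufer_angle m lam th"
    and s: "sin (th T1) = 0" "sin (th T2) = 0"
  obtains r where "\<And>t. r t > 0" "neumann_solution p q m T1 T2 lam (- lam) (\<lambda>t. r t * cos (th t))"
proof -
  \<comment> \<open>For \<open>u = r cos \<theta>\<close> and \<open>v = - r sin \<theta>\<close>,
    \<open>S\<close> is \<open>v' / r\<close> as prescribed by the equation; \<open>R\<close> then
    comes from \<open>r r' = u u' + v v'\<close>.\<close>
  define S where "S t = q t * cos (th t) - lam * m t * \<bar>cos (th t)\<bar>" for t
  define R where "R t = - sin (th t) * (cos (th t) * (1 / p t) + S t)" for t
  define r where "r t = exp (integral {T1..t} R)" for t
  define u' where "u' t = - (r t * sin (th t)) * (1 / p t)" for t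
  note contth = prufer_angle_cont[OF th]
  have contR: "continuous_on {T1..T2} R"
    unfolding R_def S_def by (intro continuous_intros contth cont_inverse_p cont_q m)
  have derr: "(r has_real_derivative r t * R t) (at t within {T1..T2})" if "t \<in> {T1..T2}" for t
    unfolding r_def using integral_has_real_derivative[OF contR that]
    by (auto intro!: derivative_eq_intros)
  have contr: "continuous_on {T1..T2} r" by (rule DERIV_continuous_on[OF derr])
  have prufer_eq: "prufer m lam t (th t) = (sin (th t))\<^sup>2 * (1 / p t) - cos (th t) * S t" for t
    by (simp add: prufer_def S_def power2_eq_square algebra_simps)
  have derth: "(th has_real_derivative (sin (th t))\<^sup>2 * (1 / p t) - cos (th t) * S t) (at t within {T1..T2})"
    if "t \<in> {T1..T2}" for t
    using th that unfolding prufer_angle_def prufer_eq by blast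
  \<comment> \<open>The product rules for \<open>u\<close> and \<open>v\<close>, with
    \<open>x = r\<close>, \<open>P = 1 / p\<close> and \<open>y = S\<close>; the factor
    \<open>c^2 + s^2\<close> is 1.\<close>
  have id1: "x * (- s * (c * P + y)) * c + (- s * (s\<^sup>2 * P - c * y)) * x = - (x * s * P) * (c\<^sup>2 + s\<^sup>2)"
    and id2: "- (x * (- s * (c * P + y)) * s + (c * (s\<^sup>2 * P - c * y)) * x) = x * y * (c\<^sup>2 + s\<^sup>2)"
    for x s c P y :: real
    by (simp_all add: power2_eq_square algebra_simps)
  have deru: "((\<lambda>t. r t * cos (th t)) has_real_derivative u' t) (at t within {T1..T2})" if t: "t \<in> {T1..T2}" for t
  proof -
    let ?T = "(sin (th t))\<^sup>2 * (1 / p t) - cos (th t) * S t"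
    have "((\<lambda>t. r t * cos (th t)) has_real_derivative
        r t * R t * cos (th t) + (- sin (th t) * ?T) * r t) (at t within {T1..T2})"
      by (rule DERIV_mult[OF derr[OF t] DERIV_chain2[OF DERIV_cos derth[OF t]]])
    also have "r t * R t * cos (th t) + (- sin (th t) * ?T) * r t
        = - (r t * sin (th t) * (1 / p t)) * ((cos (th t))\<^sup>2 + (sin (th t))\<^sup>2)"
      unfolding R_def by (rule id1)
    also have "\<dots> = u' t" by (simp add: u'_def)
    finally show ?thesis .
  qed
  have derv: "((\<lambda>t. - (r t * sin (th t))) has_real_derivative r t * S t) (at t within {T1..T2})" if t: "t \<in> {T1..T2}" for t
  proof -
    let ?T = "(sin (th t))\<^sup>2 * (1 / p t) - cos (th t) * S t"
    have "((\<lambda>t. - (r t * sin (th t))) has_real_derivative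
        - (r t * R t * sin (th t) + (cos (th t) * ?T) * r t)) (at t within {T1..T2})"
      by (rule DERIV_minus[OF DERIV_mult[OF derr[OF t] DERIV_chain2[OF DERIV_sin derth[OF t]]]])
    also have "- (r t * R t * sin (th t) + (cos (th t) * ?T) * r t)
        = r t * S t * ((cos (th t))\<^sup>2 + (sin (th t))\<^sup>2)"
      unfolding R_def by (rule id2)
    also have "\<dots> = r t * S t" by simp
    finally show ?thesis .
  qed
  have rpos: "r t > 0" for t by (simp add: r_def)
  have "neumann_solution p q m T1 T2 lam (- lam) (\<lambda>t. r t * cos (th t))"
    unfolding neumann_solution_def
  proof (intro exI[of _ u'] conjI ballI)
    show "continuous_on {T1..T2} u'"
      unfolding u'_def by (intro continuous_intros contr contth cont_inverse_p)
    show "u' T1 = 0" "u' T2 = 0" using s by (simp_all add: u'_def)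
    show "((\<lambda>t. r t * cos (th t)) has_real_derivative u' t) (at t within {T1..T2})" if "t \<in> {T1..T2}" for t
      using deru that .
    fix t assume t: "t \<in> {T1<..<T2}"
    have "((\<lambda>t. - (r t * sin (th t))) has_real_derivative r t * S t) (at t)"
      using derv[of t] t at_within_Icc_at[of T1 t T2] by simp
    then have "((\<lambda>s. p s * u' s) has_real_derivative r t * S t) (at t)"
    proof (rule has_field_derivative_transform_within_open[of _ _ _ "{T1<..<T2}"])
      fix x assume "x \<in> {T1<..<T2}"
      then show "- (r x * sin (th x)) = p x * u' x" using p_pos[of x] by (simp add: u'_def)
    qed (use t in auto)
    moreover have "lam * pos_part (\<lambda>t. r t * cos (th t)) t - - lam * neg_part (\<lambda>t. r t * cos (th t)) t
        = lam * (r t * \<bar>cos (th t)\<bar>)"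
    proof -
      have "pos_part (\<lambda>t. r t * cos (th t)) t + neg_part (\<lambda>t. r t * cos (th t)) t = \<bar>r t * cos (th t)\<bar>"
        by (simp add: pos_part_def neg_part_def max_def)
      also have "\<dots> = r t * \<bar>cos (th t)\<bar>" using rpos[of t] by (simp add: abs_mult)
      finally show ?thesis by (metis diff_minus_eq_add distrib_left mult_minus_left)
    qed
    then have "- (r t * S t) + q t * (r t * cos (th t)) =
        m t * (lam * pos_part (\<lambda>t. r t * cos (th t)) t - - lam * neg_part (\<lambda>t. r t * cos (th t)) t)"
      by (simp only: S_def) (simp add: algebra_simps)
    ultimately show "\<exists>w. ((\<lambda>s. p s * u' s) has_real_derivative w) (at t) \<and>
        - w + q t * (r t * cos (th t)) =
        m t * (lam * pos_part (\<lambda>t. r t * cos (th t)) t - - lam * neg_part (\<lambda>t. r t * cos (th t)) t)"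
      by blast
  qed
  with rpos show thesis by (rule that)
qed

lemma alternates_imp_C_gt:
  assumes m: "continuous_on {T1..T2} m" and "alternates T1 T2 k m"
  shows "C_gt p q m T1 T2 k \<inter> ({0..} \<times> {..0}) \<noteq> {}"
proof -
  obtain lam th where lam: "lam \<ge> 0" and th: "prufer_angle m lam th"
    and th12: "th T1 = - (real k * pi)" "th T2 = 0"
    using prufer_angle_shooting[OF assms] by blast
  obtain r where r: "\<And>t. r t > 0" "neumann_solution p q m T1 T2 lam (- lam) (\<lambda>t. r t * cos (th t))"
    using prufer_angle_neumann_solution[OF m th] th12 by auto
  have "r T2 * cos (th T2) > 0" using r(1)[of T2] th12 by simp
  moreover from this have "nonzero_on (\<lambda>t. r t * cos (th t)) {T1..T2}"
    unfolding nonzero_on_def using T12 by (intro bexI[of _ T2]) auto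
  moreover have "has_exactly_k_zeros k (\<lambda>t. r t * cos (th t)) {T1<..<T2}"
    using prufer_angle_zeros[OF m th th12] r(1) by (simp add: has_exactly_k_zeros_def less_imp_neq[symmetric])
  ultimately have "(lam, - lam) \<in> C_gt p q m T1 T2 k" using r(2) by (auto simp: C_gt_def)
  then show ?thesis using lam by auto
qed

lemma C_gt_iff_alternates:
  assumes "continuous_on {T1..T2} m" "1 \<le> k"
  shows "C_gt p q m T1 T2 k \<inter> ({0..} \<times> {..0}) \<noteq> {} \<longleftrightarrow> alternates T1 T2 k m"
  using C_gt_imp_alternates[OF assms] alternates_imp_C_gt[OF assms(1)] by blast

end

section \<open>Symmetries and the final count\<close>

lemma neumann_solution_uminus:
  assumes "neumann_solution p q m T1 T2 a b u"
  shows "neumann_solution p q m T1 T2 b a (\<lambda>t. - u t)"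
proof -
  obtain u' where u': "continuous_on {T1..T2} u'"
    "\<forall>t\<in>{T1..T2}. (u has_real_derivative u' t) (at t within {T1..T2})"
    "\<forall>t\<in>{T1<..<T2}. \<exists>w. ((\<lambda>s. p s * u' s) has_real_derivative w) (at t)
              \<and> - w + q t * u t = m t * (a * pos_part u t - b * neg_part u t)"
    "u' T1 = 0" "u' T2 = 0"
    using assms unfolding neumann_solution_def by blast
  show ?thesis
    unfolding neumann_solution_def
  proof (intro exI[of _ "\<lambda>t. - u' t"] conjI ballI)
    show "continuous_on {T1..T2} (\<lambda>t. - u' t)" using u'(1) by (rule continuous_on_minus)
    show "((\<lambda>t. - u t) has_real_derivative - u' t) (at t within {T1..T2})" if "t \<in> {T1..T2}" for t
      using u'(2) that by (intro DERIV_minus) blast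
    fix t assume "t \<in> {T1<..<T2}"
    then obtain w where w: "((\<lambda>s. p s * u' s) has_real_derivative w) (at t)"
      "- w + q t * u t = m t * (a * pos_part u t - b * neg_part u t)" using u'(3) by blast
    have "((\<lambda>s. p s * (- u' s)) has_real_derivative - w) (at t)" using DERIV_minus[OF w(1)] by simp
    moreover have "- (- w) + q t * (- u t) = m t * (b * pos_part (\<lambda>t. - u t) t - a * neg_part (\<lambda>t. - u t) t)"
      using w(2) by (simp add: pos_part_def neg_part_def algebra_simps)
    ultimately show "\<exists>w. ((\<lambda>s. p s * (- u' s)) has_real_derivative w) (at t) \<and>
        - w + q t * (- u t) = m t * (b * pos_part (\<lambda>t. - u t) t - a * neg_part (\<lambda>t. - u t) t)" by blast
  qed (use u' in auto)
qed

lemma neumann_solution_uminus_weight: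
  "neumann_solution p q (\<lambda>t. - m t) T1 T2 a b u \<longleftrightarrow> neumann_solution p q m T1 T2 (- a) (- b) u"
proof -
  have "- m t * (a * pos_part u t - b * neg_part u t) = m t * (- a * pos_part u t - - b * neg_part u t)" for t
    by (simp add: algebra_simps)
  then show ?thesis by (simp only: neumann_solution_def)
qed

lemma C_lt_iff_C_gt_swap: "(a, b) \<in> C_lt p q m T1 T2 k \<longleftrightarrow> (b, a) \<in> C_gt p q m T1 T2 k"
proof
  assume "(a, b) \<in> C_lt p q m T1 T2 k"
  then obtain u where "neumann_solution p q m T1 T2 a b u" "nonzero_on u {T1..T2}"
      "has_exactly_k_zeros k u {T1<..<T2}" "u T2 < 0"
    by (auto simp: C_lt_def)
  then show "(b, a) \<in> C_gt p q m T1 T2 k"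
    using neumann_solution_uminus unfolding C_gt_def
    by (auto simp: nonzero_on_def has_exactly_k_zeros_def intro!: exI[of _ "\<lambda>t. - u t"])
next
  assume "(b, a) \<in> C_gt p q m T1 T2 k"
  then obtain u where "neumann_solution p q m T1 T2 b a u" "nonzero_on u {T1..T2}"
      "has_exactly_k_zeros k u {T1<..<T2}" "u T2 > 0"
    by (auto simp: C_gt_def)
  then show "(a, b) \<in> C_lt p q m T1 T2 k"
    using neumann_solution_uminus unfolding C_lt_def
    by (auto simp: nonzero_on_def has_exactly_k_zeros_def intro!: exI[of _ "\<lambda>t. - u t"])
qed

lemma C_gt_uminus_weight: "(a, b) \<in> C_gt p q (\<lambda>t. - m t) T1 T2 k \<longleftrightarrow> (- a, - b) \<in> C_gt p q m T1 T2 k"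
  by (simp add: C_gt_def neumann_solution_uminus_weight)

theorem theorem6:
  fixes T1 T2 :: real and p q m :: "real \<Rightarrow> real" and N :: enat
  assumes "T1 < T2"
    and "continuous_on {T1..T2} p" and "continuous_on {T1..T2} q" and "continuous_on {T1..T2} m"
    and "\<And>t. t \<in> {T1..T2} \<Longrightarrow> p t > 0"
    and "\<And>t. t \<in> {T1..T2} \<Longrightarrow> q t \<ge> 0"
    and "nonzero_on m {T1..T2}"
    and "changes_sign_on m {T1<..<T2}"
    and "N = num_sign_changes m T1 T2"
  shows "1 \<le> N
    \<and> num_hyperbolic_like_curves p q m T1 T2 ({0..} \<times> {..0}) = 2 * N - 1
    \<and> num_hyperbolic_like_curves p q m T1 T2 ({..0} \<times> {0..}) = 2 * N - 1"
proof -
  interpret sturm_liouville T1 T2 p q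
    using assms by unfold_locales
  let ?Q = "{0..} \<times> {..0} :: (real \<times> real) set" and ?Q' = "{..0} \<times> {0..} :: (real \<times> real) set"
  have gt: "C_gt p q m T1 T2 k \<inter> ?Q \<noteq> {} \<longleftrightarrow> alternates T1 T2 k m" if "1 \<le> k" for k
    using C_gt_iff_alternates[OF assms(4) that] .
  have gt': "C_gt p q m T1 T2 k \<inter> ?Q' \<noteq> {} \<longleftrightarrow> alternates T1 T2 k (\<lambda>x. - m x)" if "1 \<le> k" for k
  proof -
    have "C_gt p q m T1 T2 k \<inter> ?Q' \<noteq> {} \<longleftrightarrow> C_gt p q (\<lambda>x. - m x) T1 T2 k \<inter> ?Q \<noteq> {}"
    proof
      assume "C_gt p q m T1 T2 k \<inter> ?Q' \<noteq> {}"
      then obtain a b where "(a, b) \<in> C_gt p q m T1 T2 k" "a \<le> 0" "0 \<le> b" by auto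
      then have "(- a, - b) \<in> C_gt p q (\<lambda>x. - m x) T1 T2 k \<inter> ?Q" by (simp add: C_gt_uminus_weight)
      then show "C_gt p q (\<lambda>x. - m x) T1 T2 k \<inter> ?Q \<noteq> {}" by blast
    next
      assume "C_gt p q (\<lambda>x. - m x) T1 T2 k \<inter> ?Q \<noteq> {}"
      then obtain a b where "(a, b) \<in> C_gt p q (\<lambda>x. - m x) T1 T2 k" "0 \<le> a" "b \<le> 0" by auto
      then have "(- a, - b) \<in> C_gt p q m T1 T2 k \<inter> ?Q'" by (simp add: C_gt_uminus_weight)
      then show "C_gt p q m T1 T2 k \<inter> ?Q' \<noteq> {}" by blast
    qed
    then show ?thesis using C_gt_iff_alternates[OF continuous_on_minus[OF assms(4)] that] by simp
  qed
  \<comment> \<open>\<open>C_lt\<close> in one quadrant is \<open>C_gt\<close> in the other, so each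
    quadrant receives one index set for \<open>m\<close> and one for \<open>- m\<close>, and both
    have the same count.\<close>
  have swap: "C_lt p q m T1 T2 k \<inter> (A \<times> B) \<noteq> {} \<longleftrightarrow> C_gt p q m T1 T2 k \<inter> (B \<times> A) \<noteq> {}" for k A B
    using C_lt_iff_C_gt_swap by fastforce
  have sets: "{k. 1 \<le> k \<and> C_gt p q m T1 T2 k \<inter> ?Q \<noteq> {}} = {k. 1 \<le> k \<and> alternates T1 T2 k m}"
    "{k. 1 \<le> k \<and> C_lt p q m T1 T2 k \<inter> ?Q' \<noteq> {}} = {k. 1 \<le> k \<and> alternates T1 T2 k m}"
    "{k. 1 \<le> k \<and> C_gt p q m T1 T2 k \<inter> ?Q' \<noteq> {}} = {k. 1 \<le> k \<and> alternates T1 T2 k (\<lambda>x. - m x)}"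
    "{k. 1 \<le> k \<and> C_lt p q m T1 T2 k \<inter> ?Q \<noteq> {}} = {k. 1 \<le> k \<and> alternates T1 T2 k (\<lambda>x. - m x)}"
    unfolding swap using gt gt' by blast+
  show ?thesis
    unfolding num_hyperbolic_like_curves_def sets
    using ecard_alternates[OF assms(4,8)] assms(9) by (simp add: add.commute)
qed

end
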